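(* Let $d\ge 3$. There is a positive constant $c_d$ (depending only on $d$) such that for every nonempty finite subset $\Lambda\subset\mathbb{Z}^d$ and every family $\{n(z),\ z\in\Lambda\}$ of positive integers, $$P_0\big(l_\infty(z)=n(z),\ \forall z\in\Lambda\big)\le (c_d\,\bar n)^{|\Lambda|}\,(|\Lambda|!)^{d}\, e^{-\underline{n}\,\mathrm{cap}(\Lambda)}\sum_{\gamma\in\mathcal{S}(\Lambda\setminus\{0\})}\ \prod_{i=1}^{|\Lambda\setminus\{0\}|}P_{\gamma(i-1)}\big(H(\gamma(i))<\infty\big),$$ where $$\bar n=\max_{z\in\Lambda}n(z),\qquad \underline{n}=\min_{z\in\Lambda}n(z),\qquad \mathrm{cap}(\Lambda)=\sum_{z\in\Lambda}P_z(T_\Lambda=\infty).$$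
   Context: $(S_n)_{n\ge0}$ is the aperiodic simple random walk on $\mathbb{Z}^d$: given $S_n$, the position $S_{n+1}$ is uniform on the $2d+1$ sites $\{z\in\mathbb{Z}^d:\ |z-S_n|\le 1\}$, where $|z|=|z_1|+\dots+|z_d|$. $P_x$ is the law of the walk with $S_0=x$. The local times are $l_\infty(z)=\sum_{k=0}^\infty\mathbf{1}\{S_k=z\}$. For a finite set $\Lambda$, $T_\Lambda=\inf\{n>0:\ S_n\in\Lambda\}$, and for $z\in\mathbb{Z}^d$, $H(z)=\inf\{n\ge 0:\ S_n=z\}$. For a finite subset $\Lambda'\subset\mathbb{Z}^d$, $\mathcal{S}(\Lambda')$ is the set of permutations (orderings) of the sites of $\Lambda'$; $\gamma\in\mathcal{S}(\Lambda')$ is written $\gamma=(\gamma(1),\dots,\gamma(|\Lambda'|))$, with the convention $\gamma(0)=0$ (the origin). An empty product equals $1$ and $\mathcal{S}(\emptyset)$ has one element. *)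

theory Defs
  imports "HOL-Probability.Probability" "HOL-Combinatorics.Multiset_Permutations"
begin

text \<open>
  The lattice is \<open>int ^ 'd\<close>, of dimension \<open>CARD('d)\<close>. The walk is realised on path space
  \<open>nat \<Rightarrow> int ^ 'd\<close>, and \<open>\<omega> n\<close> is its position at time \<open>n\<close> along the path \<open>\<omega>\<close>.
\<close>

definition l1_norm :: "int ^ 'd \<Rightarrow> int" where
  "l1_norm z = (\<Sum>i\<in>UNIV. \<bar>z $ i\<bar>)"

definition step_pmf :: "(int ^ 'd) pmf" where
  "step_pmf = pmf_of_set {z. l1_norm z \<le> 1}"

text \<open>
  \<open>walk x\<close> is the law of the walk started at \<open>x\<close>. Lemma \<open>walk_cylinder\<close> below shows that
  it starts at \<open>x\<close> and that, given its past, its next position is uniform on the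
  \<open>2 * CARD('d) + 1\<close> sites at distance at most 1 from the current one.
\<close>

definition walk :: "int ^ 'd \<Rightarrow> (nat \<Rightarrow> int ^ 'd) measure" where
  "walk x = distr (\<Pi>\<^sub>M k\<in>UNIV. measure_pmf step_pmf) (\<Pi>\<^sub>M k\<in>UNIV. count_space UNIV)
     (\<lambda>\<xi> n. x + (\<Sum>k<n. \<xi> k))"

definition local_time :: "(nat \<Rightarrow> 'a) \<Rightarrow> 'a \<Rightarrow> ennreal" where
  "local_time \<omega> z = (\<Sum>k. if \<omega> k = z then 1 else 0)"

text \<open>Infima are taken in \<^typ>\<open>enat\<close>, where the infimum of the empty set is \<open>\<infinity>\<close>.\<close>

definition return_time :: "'a set \<Rightarrow> (nat \<Rightarrow> 'a) \<Rightarrow> enat" where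
  "return_time \<Lambda> \<omega> = (INF n\<in>{n. 0 < n \<and> \<omega> n \<in> \<Lambda>}. enat n)"

definition hitting_time :: "'a \<Rightarrow> (nat \<Rightarrow> 'a) \<Rightarrow> enat" where
  "hitting_time z \<omega> = (INF n\<in>{n. \<omega> n = z}. enat n)"

definition capacity :: "(int ^ 'd) set \<Rightarrow> real" where
  "capacity \<Lambda> = (\<Sum>z\<in>\<Lambda>. \<P>(\<omega> in walk z. return_time \<Lambda> \<omega> = \<infinity>))"

text \<open>
  An ordering \<open>\<gamma>\<close> of a finite set of sites is a list, so \<open>\<gamma>(i)\<close>, with the convention
  \<open>\<gamma>(0) = 0\<close>, is \<open>(0 # \<gamma>) ! i\<close>.
\<close>

definition path_weight :: "(int ^ 'd) list \<Rightarrow> real" where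
  "path_weight \<gamma> =
     (\<Prod>i=1..length \<gamma>. \<P>(\<omega> in walk ((0 # \<gamma>) ! (i - 1)). hitting_time ((0 # \<gamma>) ! i) \<omega> < \<infinity>))"


subsection \<open>Basic properties of the walk\<close>

lemma l1_ball_eq:
  "{z :: int ^ 'd. l1_norm z \<le> 1} =
     insert 0 (range (\<lambda>i. axis i 1) \<union> range (\<lambda>i. axis i (-1)))" (is "?A = ?B")
proof (rule equalityI; rule subsetI)
  fix z :: "int ^ 'd" assume "z \<in> ?A"
  then have le: "(\<Sum>i\<in>UNIV. \<bar>z $ i\<bar>) \<le> 1" by (simp add: l1_norm_def)
  show "z \<in> ?B"
  proof (cases "z = 0")
    case False
    then obtain i where i: "z $ i \<noteq> 0" by (auto simp: vec_eq_iff)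
    have split: "(\<Sum>j\<in>UNIV. \<bar>z $ j\<bar>) = \<bar>z $ i\<bar> + (\<Sum>j\<in>UNIV - {i}. \<bar>z $ j\<bar>)"
      by (simp add: sum.remove)
    have nn: "(\<Sum>j\<in>UNIV - {i}. \<bar>z $ j\<bar>) \<ge> 0" by (simp add: sum_nonneg)
    from split nn le i have s0: "(\<Sum>j\<in>UNIV - {i}. \<bar>z $ j\<bar>) = 0" and a: "\<bar>z $ i\<bar> = 1"
      by linarith+
    from s0 have "\<forall>j\<in>UNIV - {i}. \<bar>z $ j\<bar> = 0"
      by (subst (asm) sum_nonneg_eq_0_iff) auto
    then have "z = axis i (z $ i)" by (auto simp: vec_eq_iff axis_def)
    moreover have "z $ i = 1 \<or> z $ i = -1" using a by linarith
    ultimately show ?thesis by (metis UnCI insertCI rangeI)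
  qed simp
next
  fix z :: "int ^ 'd" assume "z \<in> ?B"
  moreover have "l1_norm (axis i c :: int ^ 'd) = \<bar>c\<bar>" for i c
    by (simp add: l1_norm_def axis_def if_distrib cong: if_cong)
  moreover have "l1_norm (0 :: int ^ 'd) = 0" by (simp add: l1_norm_def)
  ultimately show "z \<in> ?A" by auto
qed

lemma finite_l1_ball: "finite {z :: int ^ 'd. l1_norm z \<le> 1}"
  by (simp add: l1_ball_eq)

lemma l1_ball_nonempty: "{z :: int ^ 'd. l1_norm z \<le> 1} \<noteq> {}"
  by (simp add: l1_ball_eq)

lemma card_l1_ball: "card {z :: int ^ 'd. l1_norm z \<le> 1} = 2 * CARD('d) + 1"
proof -
  have inj: "inj (\<lambda>i. axis i c :: int ^ 'd)" if "c \<noteq> 0" for c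
    using that by (auto simp: inj_on_def axis_eq_axis)
  have disj: "range (\<lambda>i. axis i 1 :: int ^ 'd) \<inter> range (\<lambda>i. axis i (-1)) = {}"
    by (auto simp: axis_eq_axis)
  have "0 \<notin> range (\<lambda>i. axis i 1 :: int ^ 'd) \<union> range (\<lambda>i. axis i (-1))"
    by (auto simp: axis_eq_0_iff dest: sym)
  then show ?thesis
    by (simp add: l1_ball_eq card_Un_disjoint[OF _ _ disj] card_image inj)
qed

lemma walk_measurable:
  "(\<lambda>\<xi> n. x + (\<Sum>k<n. \<xi> k)) \<in>
     (\<Pi>\<^sub>M k\<in>(UNIV :: nat set). measure_pmf (step_pmf :: (int ^ 'd) pmf)) \<rightarrow>\<^sub>M
     (\<Pi>\<^sub>M k\<in>UNIV. count_space UNIV)"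
proof (rule measurable_PiM_single')
  fix n :: nat
  let ?M = "\<Pi>\<^sub>M k\<in>(UNIV :: nat set). measure_pmf (step_pmf :: (int ^ 'd) pmf)"
  have comp: "(\<lambda>\<xi>. \<xi> k) \<in> ?M \<rightarrow>\<^sub>M count_space UNIV" for k
    using measurable_component_singleton[of k UNIV "\<lambda>_. measure_pmf step_pmf"]
    by (simp add: measurable_cong_sets[OF refl sets_measure_pmf_count_space])
  have "(\<lambda>\<xi>. (\<Sum>k<n. \<xi> k)) \<in> ?M \<rightarrow>\<^sub>M count_space UNIV"
  proof (induction n)
    case (Suc n)
    show ?case
      unfolding sum.lessThan_Suc
      by (rule measurable_compose_countable[OF _ Suc.IH, where f = "\<lambda>s \<xi>. s + \<xi> n"])
         (rule measurable_compose[OF comp], simp)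
  qed simp
  then show "(\<lambda>\<xi>. x + (\<Sum>k<n. \<xi> k)) \<in> ?M \<rightarrow>\<^sub>M count_space UNIV"
    by (rule measurable_compose) simp
qed auto

lemma sets_walk: "sets (walk x) = sets (\<Pi>\<^sub>M k\<in>UNIV. count_space UNIV)"
  by (simp add: walk_def)

lemma space_walk [simp]: "space (walk x) = UNIV"
  by (simp add: walk_def space_PiM)

lemma prob_space_walk: "prob_space (walk x)"
  unfolding walk_def
  by (intro prob_space.prob_space_distr walk_measurable prob_space_PiM prob_space_measure_pmf)

lemma measurable_walk [measurable]: "(\<lambda>\<omega>. \<omega> n) \<in> walk x \<rightarrow>\<^sub>M count_space UNIV"
  by (simp add: measurable_cong_sets[OF sets_walk refl])

lemma measurable_local_time [measurable]: "(\<lambda>\<omega>. local_time \<omega> z) \<in> borel_measurable (walk x)"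
  unfolding local_time_def by measurable

lemma measurable_return_time [measurable]:
  "return_time \<Lambda> \<in> walk x \<rightarrow>\<^sub>M count_space UNIV"
proof -
  have "return_time \<Lambda> = (\<lambda>\<omega>. INF n. if 0 < n \<and> \<omega> n \<in> \<Lambda> then enat n else \<infinity>)"
    unfolding return_time_def
  proof (intro ext antisym INF_greatest)
    fix \<omega> and n :: nat assume "n \<in> {n. 0 < n \<and> \<omega> n \<in> \<Lambda>}"
    then show "(INF n. if 0 < n \<and> \<omega> n \<in> \<Lambda> then enat n else \<infinity>) \<le> enat n"
      by (intro INF_lower2[of n]) auto
  qed (auto intro: INF_lower)
  then show ?thesis by (rule ssubst) measurable
qed

lemma measurable_hitting_time [measurable]:
  "hitting_time z \<in> walk x \<rightarrow>\<^sub>M count_space UNIV"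
proof -
  have "hitting_time z = (\<lambda>\<omega>. INF n. if \<omega> n = z then enat n else \<infinity>)"
    unfolding hitting_time_def
  proof (intro ext antisym INF_greatest)
    fix \<omega> and n :: nat assume "n \<in> {n. \<omega> n = z}"
    then show "(INF n. if \<omega> n = z then enat n else \<infinity>) \<le> enat n"
      by (intro INF_lower2[of n]) auto
  qed (auto intro: INF_lower)
  then show ?thesis by (rule ssubst) measurable
qed

lemma walk_cylinder:
  fixes x :: "int ^ 'd"
  shows "\<P>(\<omega> in walk x. \<forall>k\<le>n. \<omega> k = s k) =
    (if s 0 = x \<and> (\<forall>k<n. l1_norm (s (Suc k) - s k) \<le> 1) then (1 / (2 * CARD('d) + 1)) ^ n else 0)"
proof -
  let ?M = "\<Pi>\<^sub>M k\<in>(UNIV :: nat set). measure_pmf (step_pmf :: (int ^ 'd) pmf)"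
  interpret product_prob_space "\<lambda>_. measure_pmf (step_pmf :: (int ^ 'd) pmf)" "UNIV :: nat set"
    by unfold_locales
  have eq: "(\<forall>k\<le>n. x + (\<Sum>j<k. \<xi> j) = s k) \<longleftrightarrow> s 0 = x \<and> (\<forall>k<n. \<xi> k = s (Suc k) - s k)" for \<xi>
  proof (induction n)
    case (Suc n)
    have "(\<forall>k\<le>Suc n. x + (\<Sum>j<k. \<xi> j) = s k) \<longleftrightarrow>
        (\<forall>k\<le>n. x + (\<Sum>j<k. \<xi> j) = s k) \<and> x + (\<Sum>j<n. \<xi> j) + \<xi> n = s (Suc n)"
      by (auto simp: le_Suc_eq add.assoc)
    also have "\<dots> \<longleftrightarrow> (\<forall>k\<le>n. x + (\<Sum>j<k. \<xi> j) = s k) \<and> \<xi> n = s (Suc n) - s n"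
    proof (intro conj_cong refl)
      assume "\<forall>k\<le>n. x + (\<Sum>j<k. \<xi> j) = s k"
      then have "x + (\<Sum>j<n. \<xi> j) = s n" by simp
      then show "x + (\<Sum>j<n. \<xi> j) + \<xi> n = s (Suc n) \<longleftrightarrow> \<xi> n = s (Suc n) - s n"
        by (simp add: eq_diff_eq add.commute)
    qed
    finally show ?case unfolding Suc.IH by (auto simp: less_Suc_eq)
  qed auto
  have pmf: "measure (measure_pmf step_pmf) {y} = (if l1_norm y \<le> 1 then 1 / (2 * CARD('d) + 1) else 0)"
    for y :: "int ^ 'd"
    unfolding step_pmf_def measure_pmf_of_set[OF l1_ball_nonempty finite_l1_ball]
    by (simp add: card_l1_ball)
  have ev: "{\<omega>. \<forall>k\<le>n. \<omega> k = s k} \<in> sets (\<Pi>\<^sub>M k\<in>UNIV. count_space UNIV)"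
  proof -
    have "Measurable.pred (walk x) (\<lambda>\<omega>. \<forall>k\<le>n. \<omega> k = s k)" by measurable
    then show ?thesis by (simp add: pred_def sets_walk)
  qed
  have *: "(\<forall>k\<in>{..<n}. \<xi> k \<in> {s (Suc k) - s k}) \<longleftrightarrow> (\<forall>k<n. \<xi> k = s (Suc k) - s k)" for \<xi>
    by auto
  have "\<P>(\<omega> in walk x. \<forall>k\<le>n. \<omega> k = s k) = measure ?M {\<xi>. \<forall>k\<le>n. x + (\<Sum>j<k. \<xi> j) = s k}"
    using ev unfolding walk_def
    by (subst measure_distr[OF walk_measurable]) (auto simp: space_PiM vimage_def)
  also have "\<dots> = (if s 0 = x then measure ?M {\<xi>. \<forall>k\<in>{..<n}. \<xi> k \<in> {s (Suc k) - s k}} else 0)"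
    unfolding eq * by (cases "s 0 = x") simp_all
  also have "measure ?M {\<xi>. \<forall>k\<in>{..<n}. \<xi> k \<in> {s (Suc k) - s k}} =
      (\<Prod>k<n. measure (measure_pmf step_pmf) {s (Suc k) - s k})"
  proof -
    have "space ?M = UNIV" by (simp add: space_PiM)
    then show ?thesis
      using emeasure_PiM_Collect[of "{..<n}" "\<lambda>k. {s (Suc k) - s k}"]
      by (simp only: subset_UNIV finite_lessThan UNIV_I simp_thms sets_measure_pmf
          measure_pmf.emeasure_eq_measure prod_ennreal measure_nonneg emeasure_eq_measure
          prod_nonneg ennreal_inj)
  qed
  also have "\<dots> = (if \<forall>k<n. l1_norm (s (Suc k) - s k) \<le> 1 then (1 / (2 * CARD('d) + 1)) ^ n else 0)"
  proof (cases "\<forall>k<n. l1_norm (s (Suc k) - s k) \<le> 1")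
    case True
    then show ?thesis unfolding pmf by (simp add: power_divide)
  next
    case False
    then show ?thesis unfolding pmf by (auto intro!: prod_zero)
  qed
  finally show ?thesis by auto
qed

end

theory Submission
  imports Defs
begin

text \<open>
  The successive visits to \<open>\<Lambda>\<close> form a killed Markov chain. Each exit from a site \<open>z\<close> that returns to
  \<open>\<Lambda>\<close> costs at most \<open>1 - P\<^sub>z(T\<^sub>\<Lambda> = \<infinity>) \<le> exp (- P\<^sub>z(T\<^sub>\<Lambda> = \<infinity>))\<close>; over all \<open>n z\<close> exits this gives
  the factor \<open>exp (- n cap \<Lambda>)\<close>. The exceptions are the exits at which a new site \<open>y\<close> is discovered from
  an old site \<open>p\<close>: these keep the hitting probability of \<open>y\<close> from \<open>p\<close>, and choosing which
  exit of \<open>p\<close> it is costs at most the maximal local time. The discoveries form a recursive tree rooted at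
  \<open>0\<close>; summing over parents costs a factor \<open>|\<Lambda>|!\<close>.

  Hitting probabilities are comparable to \<open>|x - y|\<^sup>2\<^sup>-\<^sup>d\<close>, because \<open>(|x|\<^sup>2 + a)\<^sup>1\<^sup>-\<^sup>d\<^sup>/\<^sup>2\<close> is superharmonic for
  large \<open>a\<close> and subharmonic far from the origin for very negative \<open>a\<close>. Any tree with \<open>m\<close> edges
  can be replaced by a Hamiltonian path from its root whose product of lengths is at most \<open>2\<^sup>m m!\<close>
  times that of the tree, which costs \<open>(m!)\<^sup>d\<^sup>-\<^sup>2\<close>. The last factor \<open>m!\<close> comes from
  bounding every order of discovery by the whole sum over paths.
\<close>

subsection \<open>The Markov property\<close>

abbreviation steps :: "(nat \<Rightarrow> int ^ 'd) measure" where
  "steps \<equiv> \<Pi>\<^sub>M k\<in>UNIV. measure_pmf step_pmf"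

abbreviation paths :: "(nat \<Rightarrow> int ^ 'd) measure" where
  "paths \<equiv> \<Pi>\<^sub>M k\<in>UNIV. count_space UNIV"

abbreviation (input) shift :: "nat \<Rightarrow> (nat \<Rightarrow> 'a) \<Rightarrow> nat \<Rightarrow> 'a" where
  "shift t \<omega> \<equiv> \<lambda>k. \<omega> (t + k)"

lemma measurable_shift [measurable]: "shift t \<in> walk x \<rightarrow>\<^sub>M paths"
  by (rule measurable_PiM_single') (auto simp: measurable_walk)

lemma measurable_shift_paths [measurable]: "shift t \<in> paths \<rightarrow>\<^sub>M paths"
  using measurable_shift[of t] by (simp add: measurable_cong_sets[OF sets_walk refl])

text \<open>Cutting one increment sequence at time \<open>t\<close> and gluing on an independent
  copy with \<open>comb_seq\<close> preserves the law. \<open>past\<close> makes \<open>A\<close> an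
  event of the increments before the cut, and \<open>pos\<close> fixes the site from which the later
  ones start, so the preimage of the event is a rectangle and its measure factors.\<close>

lemma walk_markov:
  fixes x y :: "int ^ 'd"
  assumes A: "A \<in> sets paths" and B: "B \<in> sets paths"
    and past: "\<And>\<omega> \<omega>'. (\<And>k. k \<le> t \<Longrightarrow> \<omega> k = \<omega>' k) \<Longrightarrow> \<omega> \<in> A \<Longrightarrow> \<omega>' \<in> A"
    and pos: "\<And>\<omega>. \<omega> \<in> A \<Longrightarrow> \<omega> t = y"
  shows "measure (walk x) {\<omega>\<in>A. shift t \<omega> \<in> B} = measure (walk x) A * measure (walk y) B"
proof -
  let ?S = "steps :: (nat \<Rightarrow> int ^ 'd) measure"
  let ?X = "\<lambda>(x :: int ^ 'd) \<xi> n. x + (\<Sum>k<n. \<xi> k)"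
  interpret S: sequence_space "measure_pmf (step_pmf :: (int ^ 'd) pmf)"
    by unfold_locales
  have X [measurable]: "?X x \<in> ?S \<rightarrow>\<^sub>M paths" for x
    by (rule walk_measurable)
  have walk: "emeasure (walk x) E = emeasure ?S (?X x -` E)" if "E \<in> sets paths" for E and x :: "int ^ 'd"
    using that unfolding walk_def by (subst emeasure_distr[OF walk_measurable]) (auto simp: space_PiM)
  have sp: "space ?S = UNIV" "space (paths :: (nat \<Rightarrow> int ^ 'd) measure) = UNIV" by (auto simp: space_PiM)
  have vs: "?X x -` E \<in> sets ?S" if "E \<in> sets paths" for E and x :: "int ^ 'd"
    using measurable_sets[OF X that, of x] by (simp add: sp)
  let ?E = "{\<omega>\<in>A. shift t \<omega> \<in> B}"
  have "shift t -` B \<inter> space paths \<in> sets (paths :: (nat \<Rightarrow> int ^ 'd) measure)"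
    by (rule measurable_sets[OF measurable_shift_paths B])
  then have "A \<inter> (shift t -` B) \<in> sets paths" using A by (simp add: sp)
  moreover have "A \<inter> (shift t -` B) = ?E" by auto
  ultimately have E: "?E \<in> sets paths" by simp
  have eq: "?X x (comb_seq t \<xi> \<xi>') \<in> ?E \<longleftrightarrow> ?X x \<xi> \<in> A \<and> ?X y \<xi>' \<in> B" for \<xi> \<xi>'
  proof -
    have agree: "?X x (comb_seq t \<xi> \<xi>') k = ?X x \<xi> k" if "k \<le> t" for k
      using that by (auto intro!: sum.cong simp: comb_seq_def)
    have inA: "?X x (comb_seq t \<xi> \<xi>') \<in> A \<longleftrightarrow> ?X x \<xi> \<in> A"
    proof
      assume "?X x (comb_seq t \<xi> \<xi>') \<in> A"
      from past[OF agree this] show "?X x \<xi> \<in> A" .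
    next
      assume "?X x \<xi> \<in> A"
      from past[OF agree[symmetric] this] show "?X x (comb_seq t \<xi> \<xi>') \<in> A" .
    qed
    have "shift t (?X x (comb_seq t \<xi> \<xi>')) = ?X y \<xi>'" if "?X x \<xi> \<in> A"
    proof
      fix k
      have "(\<Sum>j<t + k. comb_seq t \<xi> \<xi>' j) = (\<Sum>j<t. comb_seq t \<xi> \<xi>' j) + (\<Sum>j<k. comb_seq t \<xi> \<xi>' (t + j))"
        by (induction k) (auto simp: add.assoc)
      also have "(\<Sum>j<t. comb_seq t \<xi> \<xi>' j) = (\<Sum>j<t. \<xi> j)"
        by (auto intro!: sum.cong simp: comb_seq_def)
      also have "(\<Sum>j<k. comb_seq t \<xi> \<xi>' (t + j)) = (\<Sum>j<k. \<xi>' j)"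
        by (auto intro!: sum.cong simp: comb_seq_def)
      finally show "shift t (?X x (comb_seq t \<xi> \<xi>')) k = ?X y \<xi>' k"
        using pos[OF that] by (simp add: add.assoc [symmetric])
    qed
    then show ?thesis using inA by auto
  qed
  have "emeasure (walk x) ?E = emeasure ?S (?X x -` ?E)" by (rule walk[OF E])
  also have "\<dots> = emeasure (distr (?S \<Otimes>\<^sub>M ?S) ?S (\<lambda>(\<xi>, \<xi>'). comb_seq t \<xi> \<xi>')) (?X x -` ?E)"
    by (subst S.PiM_comb_seq) simp
  also have "\<dots> = emeasure (?S \<Otimes>\<^sub>M ?S) ((\<lambda>(\<xi>, \<xi>'). comb_seq t \<xi> \<xi>') -` (?X x -` ?E) \<inter> space (?S \<Otimes>\<^sub>M ?S))"
    by (rule emeasure_distr[OF measurable_comb_seq vs[OF E]])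
  also have "(\<lambda>(\<xi>, \<xi>'). comb_seq t \<xi> \<xi>') -` (?X x -` ?E) \<inter> space (?S \<Otimes>\<^sub>M ?S) =
      (?X x -` A) \<times> (?X y -` B)"
    using eq by (auto simp: space_pair_measure sp)
  also have "emeasure (?S \<Otimes>\<^sub>M ?S) \<dots> = emeasure ?S (?X x -` A) * emeasure ?S (?X y -` B)"
    by (rule S.P.emeasure_pair_measure_Times) (auto intro: vs A B)
  also have "\<dots> = emeasure (walk x) A * emeasure (walk y) B"
    using A B by (simp add: walk)
  finally show ?thesis
    by (simp add: measure_def enn2real_mult)
qed

text \<open>\<open>A t\<close> stands for a stopping time taking the value \<open>t\<close> with the
  walk then at \<open>y\<close>. Disjointness allows the Markov property at fixed times to be summed
  over \<open>t\<close>.\<close>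

lemma walk_strong_markov:
  fixes x y :: "int ^ 'd" and A :: "nat \<Rightarrow> (nat \<Rightarrow> int ^ 'd) set"
  assumes A: "\<And>t. A t \<in> sets paths" and B: "B \<in> sets paths"
    and past: "\<And>t \<omega> \<omega>'. (\<And>k. k \<le> t \<Longrightarrow> \<omega> k = \<omega>' k) \<Longrightarrow> \<omega> \<in> A t \<Longrightarrow> \<omega>' \<in> A t"
    and pos: "\<And>t \<omega>. \<omega> \<in> A t \<Longrightarrow> \<omega> t = y"
    and disj: "disjoint_family A"
  shows "measure (walk x) (\<Union>t. {\<omega>\<in>A t. shift t \<omega> \<in> B}) = measure (walk x) (\<Union>t. A t) * measure (walk y) B"
proof -
  interpret prob_space "walk x" by (rule prob_space_walk)
  have E: "{\<omega>\<in>A t. shift t \<omega> \<in> B} \<in> sets paths" for t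
  proof -
    have "A t \<inter> (shift t -` B \<inter> space paths) \<in> sets paths"
      by (intro sets.Int A measurable_sets[OF measurable_shift_paths B])
    moreover have "A t \<inter> (shift t -` B \<inter> space paths) = {\<omega>\<in>A t. shift t \<omega> \<in> B}"
      by (auto simp: space_PiM)
    ultimately show ?thesis by simp
  qed
  have "(\<lambda>t. measure (walk x) (A t)) sums measure (walk x) (\<Union>t. A t)"
    using A disj by (intro finite_measure_UNION) (auto simp: sets_walk)
  then have "(\<lambda>t. measure (walk x) (A t) * measure (walk y) B) sums (measure (walk x) (\<Union>t. A t) * measure (walk y) B)"
    by (rule sums_mult2)
  moreover have "(\<lambda>t. measure (walk x) (A t) * measure (walk y) B) =
      (\<lambda>t. measure (walk x) {\<omega>\<in>A t. shift t \<omega> \<in> B})"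
  proof
    fix t
    have "measure (walk x) {\<omega>\<in>A t. shift t \<omega> \<in> B} = measure (walk x) (A t) * measure (walk y) B"
    proof (rule walk_markov)
      fix \<omega> \<omega>' :: "nat \<Rightarrow> int ^ 'd"
      assume "\<And>k. k \<le> t \<Longrightarrow> \<omega> k = \<omega>' k" "\<omega> \<in> A t"
      then show "\<omega>' \<in> A t" using past[of t \<omega> \<omega>'] by blast
    qed (fact A B pos)+
    then show "measure (walk x) (A t) * measure (walk y) B = measure (walk x) {\<omega>\<in>A t. shift t \<omega> \<in> B}"
      by simp
  qed
  moreover have "(\<lambda>t. measure (walk x) {\<omega>\<in>A t. shift t \<omega> \<in> B}) sums measure (walk x) (\<Union>t. {\<omega>\<in>A t. shift t \<omega> \<in> B})"
    using E disj by (intro finite_measure_UNION) (auto simp: sets_walk disjoint_family_on_def)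
  ultimately show ?thesis by (simp only: sums_iff)
qed

subsection \<open>Hitting probabilities as harmonic functions\<close>

text \<open>The one-step transition operator of the walk; harmonicity at \<open>x\<close> is
  \<open>mean f x = f x\<close>.\<close>

definition mean :: "(int ^ 'd \<Rightarrow> real) \<Rightarrow> int ^ 'd \<Rightarrow> real" where
  "mean f x = (\<Sum>e | l1_norm e \<le> 1. f (x + e)) / (2 * CARD('d) + 1)"

lemma mean_mono: "(\<And>x. f x \<le> g x) \<Longrightarrow> mean f x \<le> mean g x"
  by (auto simp: mean_def intro!: divide_right_mono sum_mono)

lemma mean_add: "mean (\<lambda>x. f x + g x) x = mean f x + mean g x"
  by (simp add: mean_def sum.distrib add_divide_distrib)

lemma mean_cmult: "mean (\<lambda>x. c * f x) x = c * mean f x"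
  by (simp add: mean_def sum_distrib_left)

lemma mean_sum: "mean (\<lambda>x. \<Sum>y\<in>F. G y x) x = (\<Sum>y\<in>F. mean (G y) x)"
  by (simp add: mean_def sum.swap[of _ F] sum_divide_distrib)

lemma mean_const: "mean (\<lambda>x. c) (x :: int ^ 'd) = c"
  by (simp add: mean_def card_l1_ball add.commute)

lemma mean_translate: "mean (\<lambda>x. f (x - y)) x = mean f (x - y)"
  by (simp add: mean_def algebra_simps)

lemma mean_axis:
  fixes x :: "int ^ 'd"
  shows "mean f x = (f x + (\<Sum>i\<in>UNIV. f (x + axis i 1) + f (x + axis i (-1)))) / (2 * CARD('d) + 1)"
proof -
  have inj: "inj (\<lambda>i. axis i c :: int ^ 'd)" if "c \<noteq> 0" for c
    using that by (auto simp: inj_on_def axis_eq_axis)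
  have disj: "range (\<lambda>i. axis i 1 :: int ^ 'd) \<inter> range (\<lambda>i. axis i (-1)) = {}"
    by (auto simp: axis_eq_axis)
  have "0 \<notin> range (\<lambda>i. axis i 1 :: int ^ 'd) \<union> range (\<lambda>i. axis i (-1))"
    by (auto simp: axis_eq_0_iff dest: sym)
  then have "(\<Sum>e | l1_norm e \<le> 1. f (x + e)) =
      f x + ((\<Sum>e\<in>range (\<lambda>i. axis i 1). f (x + e)) + (\<Sum>e\<in>range (\<lambda>i. axis i (-1)). f (x + e)))"
    by (subst l1_ball_eq) (simp add: sum.union_disjoint[OF _ _ disj])
  then show ?thesis
    by (simp add: mean_def sum.reindex inj sum.distrib)
qed

section \<open>First-step analysis\<close>

lemma walk_prob_cong:
  assumes "AE \<omega> in walk x. P \<omega> \<longleftrightarrow> Q \<omega>"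
    and "Measurable.pred (walk x) P" "Measurable.pred (walk x) Q"
  shows "\<P>(\<omega> in walk x. P \<omega>) = \<P>(\<omega> in walk x. Q \<omega>)"
  using assms by (intro measure_eq_AE) (auto simp: pred_def)

lemma walk_start: "\<P>(\<omega> in walk x. \<omega> 0 = x) = 1"
  using walk_cylinder[of x 0 "\<lambda>_. x"] by simp

lemma AE_walk_start: "AE \<omega> in walk x. \<omega> 0 = x"
proof -
  interpret prob_space "walk x" by (rule prob_space_walk)
  have "{\<omega> \<in> space (walk x). \<omega> 0 = x} \<in> events" by measurable
  from prob_Collect_eq_1[OF this] show ?thesis using walk_start[of x] by simp
qed

lemma walk_first_step:
  fixes x e :: "int ^ 'd"
  assumes "l1_norm e \<le> 1"
  shows "\<P>(\<omega> in walk x. \<omega> 1 = x + e) = 1 / (2 * CARD('d) + 1)"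
proof -
  interpret prob_space "walk x" by (rule prob_space_walk)
  have "\<P>(\<omega> in walk x. \<omega> 1 = x + e) =
      \<P>(\<omega> in walk x. \<forall>k\<le>1. \<omega> k = (if k = 0 then x else x + e))"
  proof (rule walk_prob_cong)
    show "AE \<omega> in walk x. \<omega> 1 = x + e \<longleftrightarrow> (\<forall>k\<le>1. \<omega> k = (if k = 0 then x else x + e))"
      using AE_walk_start[of x] by eventually_elim (auto simp: le_Suc_eq)
  qed measurable
  then show ?thesis using assms walk_cylinder[of x 1 "\<lambda>k. if k = 0 then x else x + e"] by simp
qed

text \<open>The \<open>2 * CARD('d) + 1\<close> admissible first positions have equal probabilities
  that already add up to one.\<close>

lemma AE_walk_first_step: "AE \<omega> in walk x. l1_norm (\<omega> 1 - x) \<le> 1"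
proof -
  interpret prob_space "walk x" by (rule prob_space_walk)
  have "prob (\<Union>e\<in>{e. l1_norm e \<le> 1}. {\<omega>. \<omega> 1 = x + e}) =
      (\<Sum>e | l1_norm e \<le> 1. prob {\<omega>. \<omega> 1 = x + e})"
  proof (rule finite_measure_finite_Union)
    have "Measurable.pred (walk x) (\<lambda>\<omega>. \<omega> 1 = x + e)" for e by measurable
    then show "(\<lambda>e. {\<omega>. \<omega> 1 = x + e}) ` {e. l1_norm e \<le> 1} \<subseteq> events"
      by (auto simp: pred_def)
  qed (auto simp: finite_l1_ball disjoint_family_on_def)
  also have "\<dots> = 1"
    using walk_first_step[of _ x] by (simp add: card_l1_ball)
  also have "(\<Union>e\<in>{e. l1_norm e \<le> 1}. {\<omega>. \<omega> 1 = x + e}) = {\<omega>\<in>space (walk x). l1_norm (\<omega> 1 - x) \<le> 1}"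
    by (auto simp: algebra_simps)
  finally have "prob {\<omega>\<in>space (walk x). l1_norm (\<omega> 1 - x) \<le> 1} = 1" .
  moreover have "{\<omega> \<in> space (walk x). l1_norm (\<omega> 1 - x) \<le> 1} \<in> events"
    using measurable_sets[OF measurable_walk[of 1 x], of "{z. l1_norm (z - x) \<le> 1}"]
    by (simp add: vimage_def)
  ultimately show ?thesis
    using prob_Collect_eq_1[of "\<lambda>\<omega>. l1_norm (\<omega> 1 - x) \<le> 1"] by simp
qed

text \<open>Condition on the first position: almost surely it is one of finitely many, and on each
  piece the Markov property at time one applies.\<close>

lemma walk_one_step:
  fixes x :: "int ^ 'd"
  assumes B: "B \<in> sets paths"
  shows "measure (walk x) {\<omega>. shift 1 \<omega> \<in> B} = mean (\<lambda>x'. measure (walk x') B) x"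
proof -
  interpret prob_space "walk x" by (rule prob_space_walk)
  let ?A = "\<lambda>e. {\<omega>. \<omega> 1 = x + e}"
  have A: "?A e \<in> events" for e
  proof -
    have "Measurable.pred (walk x) (\<lambda>\<omega>. \<omega> 1 = x + e)" by measurable
    then show ?thesis by (simp add: pred_def)
  qed
  have sB: "{\<omega>. shift 1 \<omega> \<in> B} \<in> events"
    using measurable_sets[OF measurable_shift[of 1 x] B] by (simp add: vimage_def)
  have AB: "{\<omega>\<in>?A e. shift 1 \<omega> \<in> B} \<in> events" for e
  proof -
    have "{\<omega>\<in>?A e. shift 1 \<omega> \<in> B} = ?A e \<inter> {\<omega>. shift 1 \<omega> \<in> B}" by auto
    then show ?thesis using A[of e] sB by simp
  qed
  have "prob {\<omega>. shift 1 \<omega> \<in> B} = prob (\<Union>e\<in>{e. l1_norm e \<le> 1}. {\<omega>\<in>?A e. shift 1 \<omega> \<in> B})"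
  proof (rule finite_measure_eq_AE)
    show "AE \<omega> in walk x. (\<omega> \<in> {\<omega>. shift 1 \<omega> \<in> B}) =
        (\<omega> \<in> (\<Union>e\<in>{e. l1_norm e \<le> 1}. {\<omega>\<in>?A e. shift 1 \<omega> \<in> B}))"
      using AE_walk_first_step[of x]
    proof eventually_elim
      case (elim \<omega>)
      have "\<omega> 1 = x + (\<omega> 1 - x)" by simp
      then show ?case using elim by blast
    qed
  qed (use sB AB finite_l1_ball in \<open>auto intro!: sets.finite_UN\<close>)
  also have "\<dots> = (\<Sum>e | l1_norm e \<le> 1. prob {\<omega>\<in>?A e. shift 1 \<omega> \<in> B})"
    using AB by (intro finite_measure_finite_Union) (auto simp: finite_l1_ball disjoint_family_on_def)
  also have "\<dots> = (\<Sum>e | l1_norm e \<le> 1. measure (walk (x + e)) B / (2 * CARD('d) + 1))"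
  proof (rule sum.cong[OF refl])
    fix e :: "int ^ 'd" assume e: "e \<in> {e. l1_norm e \<le> 1}"
    have "prob {\<omega>\<in>?A e. shift 1 \<omega> \<in> B} = prob (?A e) * measure (walk (x + e)) B"
      by (rule walk_markov) (use A[of e] B in \<open>auto simp: sets_walk\<close>)
    also have "prob (?A e) = 1 / (2 * CARD('d) + 1)"
      using walk_first_step[of e x] e by simp
    finally show "prob {\<omega>\<in>?A e. shift 1 \<omega> \<in> B} = measure (walk (x + e)) B / (2 * CARD('d) + 1)"
      by simp
  qed
  also have "\<dots> = mean (\<lambda>x'. measure (walk x') B) x"
    by (simp add: mean_def sum_divide_distrib)
  finally show ?thesis .
qed

section \<open>Hitting probabilities as limits of finite-horizon ones\<close>

lemma paths_event: "(\<And>x. Measurable.pred (walk x) P) \<Longrightarrow> {\<omega>. P \<omega>} \<in> sets paths"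
  using sets_walk by (simp add: pred_def) blast

text \<open>The probability that the walk from \<open>x\<close> meets the origin by time
  \<open>n\<close>. The recursive form lets comparison arguments run by induction on
  \<open>n\<close>, using only the monotonicity and linearity of \<open>mean\<close>.\<close>

primrec hit_by :: "nat \<Rightarrow> int ^ 'd \<Rightarrow> real" where
  "hit_by 0 = (\<lambda>x. of_bool (x = 0))"
| "hit_by (Suc n) = (\<lambda>x. if x = 0 then 1 else mean (hit_by n) x)"

lemma hit_by_eq: "\<P>(\<omega> in walk x. \<exists>k\<le>n. \<omega> k = y) = hit_by n (x - y)"
proof (induction n arbitrary: x)
  case 0
  interpret prob_space "walk x" by (rule prob_space_walk)
  have "\<P>(\<omega> in walk x. \<exists>k\<le>0. \<omega> k = y) = \<P>(\<omega> in walk x. x = y)"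
  proof (rule walk_prob_cong)
    show "AE \<omega> in walk x. (\<exists>k\<le>0. \<omega> k = y) \<longleftrightarrow> x = y"
      using AE_walk_start[of x] by eventually_elim auto
  qed measurable
  then show ?case using prob_space by (cases "x = y") auto
next
  case (Suc n)
  interpret prob_space "walk x" by (rule prob_space_walk)
  show ?case
  proof (cases "x = y")
    case True
    have "\<P>(\<omega> in walk x. \<exists>k\<le>Suc n. \<omega> k = y) = \<P>(\<omega> in walk x. True)"
    proof (rule walk_prob_cong)
      show "AE \<omega> in walk x. (\<exists>k\<le>Suc n. \<omega> k = y) \<longleftrightarrow> True"
        using AE_walk_start[of x] by eventually_elim (use True in auto)
    qed measurable
    then show ?thesis using prob_space True by auto
  next
    case False
    let ?B = "{\<omega>. \<exists>k\<le>n. \<omega> k = y}"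
    have iff: "(\<exists>k\<le>Suc n. \<omega> k = y) \<longleftrightarrow> \<omega> 0 = y \<or> shift 1 \<omega> \<in> ?B" for \<omega>
      unfolding atMost_def[symmetric] atMost_iff[symmetric] Bex_def[symmetric] atMost_Suc_eq_insert_0
      by auto
    have B: "?B \<in> sets paths"
      by (rule paths_event) measurable
    have sB: "{\<omega>. shift 1 \<omega> \<in> ?B} \<in> events"
      using measurable_sets[OF measurable_shift[of 1 x] B] by (simp add: vimage_def)
    have "\<P>(\<omega> in walk x. \<exists>k\<le>Suc n. \<omega> k = y) = \<P>(\<omega> in walk x. shift 1 \<omega> \<in> ?B)"
    proof (rule walk_prob_cong)
      show "AE \<omega> in walk x. (\<exists>k\<le>Suc n. \<omega> k = y) \<longleftrightarrow> shift 1 \<omega> \<in> ?B"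
        using AE_walk_start[of x] by eventually_elim (use False in \<open>simp add: iff\<close>)
      show "Measurable.pred (walk x) (\<lambda>\<omega>. shift 1 \<omega> \<in> ?B)"
        using sB by (simp add: pred_def)
    qed measurable
    also have "\<dots> = prob {\<omega>. shift 1 \<omega> \<in> ?B}" by simp
    also have "\<dots> = mean (\<lambda>x'. measure (walk x') ?B) x"
      by (rule walk_one_step[OF B])
    also have "(\<lambda>x'. measure (walk x') ?B) = (\<lambda>x'. hit_by n (x' - y))"
      using Suc.IH by simp
    finally show ?thesis using False by (simp add: mean_translate)
  qed
qed

definition hit :: "int ^ 'd \<Rightarrow> int ^ 'd \<Rightarrow> real" where
  "hit x y = \<P>(\<omega> in walk x. hitting_time y \<omega> < \<infinity>)"

lemma hitting_time_finite: "hitting_time y \<omega> < \<infinity> \<longleftrightarrow> (\<exists>k. \<omega> k = y)"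
  unfolding hitting_time_def INF_less_iff by auto

lemma hit_by_tendsto: "(\<lambda>n. hit_by n (x - y)) \<longlonglongrightarrow> hit x y"
proof -
  interpret prob_space "walk x" by (rule prob_space_walk)
  have "(\<lambda>n. prob {\<omega>. \<exists>k\<le>n. \<omega> k = y}) \<longlonglongrightarrow> prob (\<Union>n. {\<omega>. \<exists>k\<le>n. \<omega> k = y})"
  proof (rule finite_Lim_measure_incseq)
    have "{\<omega>. \<exists>k\<le>n. \<omega> k = y} \<in> sets paths" for n
      by (rule paths_event) measurable
    then show "range (\<lambda>n. {\<omega>. \<exists>k\<le>n. \<omega> k = y}) \<subseteq> events" by (auto simp: sets_walk)
  qed (auto simp: incseq_def intro: order_trans)
  moreover have "(\<Union>n. {\<omega>. \<exists>k\<le>n. \<omega> k = y}) = {\<omega>. hitting_time y \<omega> < \<infinity>}"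
    unfolding hitting_time_finite by auto
  ultimately show ?thesis using hit_by_eq[of x _ y] by (simp add: hit_def)
qed

text \<open>By translation invariance this function of the displacement carries all hitting
  probabilities.\<close>

definition hit0 :: "int ^ 'd \<Rightarrow> real" where "hit0 x = hit x 0"

lemma hit_by_tendsto0: "(\<lambda>n. hit_by n x) \<longlonglongrightarrow> hit0 x"
  using hit_by_tendsto[of x 0] by (simp add: hit0_def)

text \<open>Both sides are limits of the same sequence \<open>hit_by n (x - y)\<close>.\<close>

lemma hit_eq_hit0: "hit x y = hit0 (x - y)"
  using LIMSEQ_unique[OF hit_by_tendsto hit_by_tendsto0] .

lemma hit0_0 [simp]: "hit0 (0 :: int ^ 'd) = 1"
proof -
  have "hit_by n (0 :: int ^ 'd) = 1" for n by (cases n) auto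
  then have "(\<lambda>n. 1) \<longlonglongrightarrow> hit0 (0 :: int ^ 'd)" using hit_by_tendsto0[of "0 :: int ^ 'd"] by simp
  then show ?thesis by (simp add: LIMSEQ_const_iff)
qed

lemma hit0_nonneg: "hit0 x \<ge> 0" by (simp add: hit0_def hit_def)

lemma hit0_harmonic:
  assumes "x \<noteq> 0"
  shows "mean hit0 x = hit0 x"
proof -
  have "(\<lambda>n. mean (hit_by n) x) \<longlonglongrightarrow> mean hit0 x"
    unfolding mean_def by (intro tendsto_intros hit_by_tendsto0) auto
  moreover have "(\<lambda>n. hit_by (Suc n) x) \<longlonglongrightarrow> hit0 x"
    by (rule LIMSEQ_Suc[OF hit_by_tendsto0])
  ultimately show ?thesis using assms LIMSEQ_unique by auto
qed

text \<open>From \<open>x \<noteq> 0\<close> some admissible step reduces the norm; by harmonicity,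
  positivity at that neighbour passes to \<open>x\<close>.\<close>

lemma hit0_pos: "hit0 x > 0"
proof (induction "nat (l1_norm x)" arbitrary: x rule: less_induct)
  case less
  show ?case
  proof (cases "x = 0")
    case False
    then obtain i where i: "x $ i \<noteq> 0" by (auto simp: vec_eq_iff)
    \<comment> \<open>The step that moves a nonzero coordinate one unit towards zero.\<close>
    define e :: "int ^ 'a" where "e = axis i (- sgn (x $ i))"
    have e: "l1_norm e \<le> 1"
      using i by (auto simp: e_def l1_norm_def axis_def if_distrib abs_sgn_eq cong: if_cong)
    have "l1_norm (x + e) < l1_norm x"
      unfolding l1_norm_def
    proof (rule sum_strict_mono_ex1)
      show "\<forall>j\<in>UNIV. \<bar>(x + e) $ j\<bar> \<le> \<bar>x $ j\<bar>"
        by (auto simp: e_def axis_def sgn_if)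
      show "\<exists>j\<in>UNIV. \<bar>(x + e) $ j\<bar> < \<bar>x $ j\<bar>"
        using i by (intro bexI[of _ i]) (auto simp: e_def axis_def sgn_if)
    qed simp
    moreover have "l1_norm (x + e) \<ge> 0" by (simp add: l1_norm_def sum_nonneg)
    ultimately have pos: "hit0 (x + e) > 0" using less by auto
    have "0 < (\<Sum>e | l1_norm e \<le> 1. hit0 (x + e))"
      using e pos by (intro sum_pos2[OF finite_l1_ball, of e]) (auto simp: hit0_nonneg)
    then have "mean hit0 x > 0" by (simp add: mean_def)
    then show ?thesis using hit0_harmonic[OF False] by simp
  qed simp
qed

text \<open>An analytic form of optional stopping: averaging preserves the bound of
  \<open>hit_by n\<close> times \<open>f 0\<close> by \<open>f\<close>, because \<open>f\<close> is
  superharmonic; then \<open>n\<close> tends to infinity.\<close>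

lemma hit0_le_superharmonic:
  assumes nonneg: "\<And>x. f x \<ge> 0" and super: "\<And>x. mean f x \<le> f x"
  shows "hit0 x * f 0 \<le> f x"
proof -
  have "hit_by n x * f 0 \<le> f x" for n
  proof (induction n arbitrary: x)
    case (Suc n)
    have "mean (hit_by n) x * f 0 = mean (\<lambda>x. f 0 * hit_by n x) x" by (simp add: mean_cmult)
    also have "\<dots> \<le> mean f x" using Suc by (intro mean_mono) (simp add: mult.commute)
    also have "\<dots> \<le> f x" by (rule super)
    finally show ?case by auto
  qed (auto simp: nonneg)
  moreover have "(\<lambda>n. hit_by n x * f 0) \<longlonglongrightarrow> hit0 x * f 0"
    by (intro tendsto_intros hit_by_tendsto0)
  ultimately show ?thesis by (auto intro: LIMSEQ_le_const2)
qed

text \<open>The iterates are the transition probabilities to \<open>y\<close>. Each expected visit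
  to \<open>y\<close> consumes the amount \<open>f y - mean f y\<close> of the nonnegative
  \<open>f\<close>, so the Green function is finite and the terms of its series vanish.\<close>

lemma mean_funpow_tendsto_0:
  fixes f :: "int ^ 'd \<Rightarrow> real"
  assumes nonneg: "\<And>x. f x \<ge> 0" and super: "\<And>x. mean f x \<le> f x" and strict: "mean f y < f y"
  shows "(\<lambda>n. (mean ^^ n) (\<lambda>z. of_bool (z = y)) x) \<longlonglongrightarrow> 0"
proof -
  let ?p = "\<lambda>n. (mean ^^ n) (\<lambda>z. of_bool (z = y)) x"
  define a where "a = f y - mean f y"
  have a: "a > 0" using strict by (simp add: a_def)
  have p_nonneg: "(mean ^^ n) (\<lambda>z. of_bool (z = y)) x \<ge> 0" for n x
    by (induction n arbitrary: x) (auto simp: mean_def intro!: divide_nonneg_nonneg sum_nonneg)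
  \<comment> \<open>The Green function truncated at time \<open>n\<close>, bounded by peeling off
    the term at time zero and averaging the rest.\<close>
  have "a * (\<Sum>k<n. (mean ^^ k) (\<lambda>z. of_bool (z = y)) x) \<le> f x" for n x
  proof (induction n arbitrary: x)
    case (Suc n)
    have "mean (\<lambda>x. a * (\<Sum>k<n. (mean ^^ k) (\<lambda>z. of_bool (z = y)) x)) x =
        a * (\<Sum>k<n. (mean ^^ Suc k) (\<lambda>z. of_bool (z = y)) x)"
      by (simp add: mean_cmult) (simp add: mean_def sum.swap[of _ "{..<n}"] sum_divide_distrib)
    moreover have "mean (\<lambda>x. a * (\<Sum>k<n. (mean ^^ k) (\<lambda>z. of_bool (z = y)) x)) x \<le> mean f x"
      by (rule mean_mono) (rule Suc)
    moreover have "a * of_bool (x = y) + mean f x \<le> f x"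
      using super[of x] by (auto simp: a_def)
    ultimately show ?case
      by (subst sum.lessThan_Suc_shift) (simp add: distrib_left)
  qed (simp add: nonneg)
  then have "(\<Sum>k<n. ?p k) \<le> f x / a" for n
    using a by (simp add: field_simps)
  then have "summable ?p"
    using p_nonneg by (intro summableI_nonneg_bounded) auto
  then show ?thesis by (rule summable_LIMSEQ_zero)
qed

text \<open>
  The bound of \<open>g\<close> by \<open>hit0\<close> plus \<open>mean ^^ n\<close> of the positive part of \<open>g\<close> propagates in \<open>n\<close>, and the
  second term vanishes by transience because \<open>g\<close> tends to \<open>0\<close> at infinity.
\<close>

lemma subharmonic_le_hit0:
  fixes g :: "int ^ 'd \<Rightarrow> real"
  assumes inside: "\<And>x. x \<in> K \<Longrightarrow> g x \<le> hit0 x" and "0 \<in> K"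
    and sub: "\<And>x. x \<notin> K \<Longrightarrow> g x \<le> mean g x"
    and fin: "\<And>\<epsilon>. \<epsilon> > 0 \<Longrightarrow> finite {x. g x > \<epsilon>}"
    and transient: "\<And>x y. (\<lambda>n. (mean ^^ n) (\<lambda>z. of_bool (z = y)) (x :: int ^ 'd)) \<longlonglongrightarrow> 0"
  shows "g x \<le> hit0 x"
proof (rule field_le_epsilon)
  fix \<epsilon> :: real assume \<epsilon>: "\<epsilon> > 0"
  define F where "F = {x. g x > \<epsilon>}"
  have F: "finite F" using fin[OF \<epsilon>] by (simp add: F_def)
  \<comment> \<open>\<open>g\<close> exceeds \<open>\<epsilon>\<close> only on the finite set
    \<open>F\<close>, so \<open>?h\<close> dominates \<open>g\<close>. Its iterates are
    \<open>\<epsilon>\<close> plus finitely many multiples of transition probabilities.\<close>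
  let ?h = "\<lambda>x. \<epsilon> + (\<Sum>y\<in>F. g y * of_bool (x = y))"
  have pow: "(mean ^^ n) ?h x = \<epsilon> + (\<Sum>y\<in>F. g y * (mean ^^ n) (\<lambda>x. of_bool (x = y)) x)" for n x
  proof (induction n arbitrary: x)
    case (Suc n)
    have "(mean ^^ Suc n) ?h x = mean (\<lambda>x. \<epsilon> + (\<Sum>y\<in>F. g y * (mean ^^ n) (\<lambda>x. of_bool (x = y)) x)) x"
    proof -
      have "(mean ^^ n) ?h = (\<lambda>x. \<epsilon> + (\<Sum>y\<in>F. g y * (mean ^^ n) (\<lambda>x. of_bool (x = y)) x))"
        using Suc by (rule ext)
      then show ?thesis by simp
    qed
    then show ?case
      by (simp add: mean_add mean_const mean_cmult
          mean_sum[where G = "\<lambda>y x. g y * (mean ^^ n) (\<lambda>x. of_bool (x = y)) x"])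
  qed simp
  have h: "?h x \<ge> 0" "g x \<le> ?h x" for x
  proof -
    have "(\<Sum>y\<in>F. g y * of_bool (x = y)) = (if x \<in> F then g x else 0)"
      using F by (simp add: of_bool_def if_distrib cong: if_cong)
    then show "?h x \<ge> 0" "g x \<le> ?h x" using \<epsilon> by (auto simp: F_def)
  qed
  have pow_nonneg: "(mean ^^ n) ?h x \<ge> 0" for n x
    by (induction n arbitrary: x) (auto simp: h(1) mean_def[of "(mean ^^ _) _"] intro!: divide_nonneg_nonneg sum_nonneg)
  have "g x \<le> hit0 x + (mean ^^ n) ?h x" for n
  proof (induction n arbitrary: x)
    case 0
    show ?case using h(2)[of x] hit0_nonneg[of x] by simp
  next
    case (Suc n)
    show ?case
    proof (cases "x \<in> K")
      case True
      then show ?thesis using inside[of x] pow_nonneg[of "Suc n" x] by linarith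
    next
      case False
      then have "x \<noteq> 0" using \<open>0 \<in> K\<close> by auto
      have "g x \<le> mean g x" by (rule sub[OF False])
      also have "\<dots> \<le> mean (\<lambda>x. hit0 x + (mean ^^ n) ?h x) x" by (rule mean_mono) (rule Suc)
      also have "\<dots> = hit0 x + (mean ^^ Suc n) ?h x"
        using hit0_harmonic[OF \<open>x \<noteq> 0\<close>] by (simp add: mean_add)
      finally show ?thesis .
    qed
  qed
  moreover have "(\<lambda>n. hit0 x + (mean ^^ n) ?h x) \<longlonglongrightarrow> hit0 x + (\<epsilon> + (\<Sum>y\<in>F. g y * 0))"
    unfolding pow by (intro tendsto_intros transient)
  ultimately show "g x \<le> hit0 x + \<epsilon>" by (auto intro: LIMSEQ_le_const)
qed

subsection \<open>The potential at the critical exponent\<close>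

text \<open>It will be applied with \<open>y\<close> of order \<open>v powr (-1/2)\<close>, so that
  a quartic remainder has the order \<open>1 / v\<^sup>2\<close> of the quantity to be
  resolved.\<close>

lemma powr_Taylor_4:
  fixes s :: real
  obtains K where "K \<ge> 0"
    "\<And>y. \<bar>y\<bar> \<le> 1/2 \<Longrightarrow>
      \<bar>(1 + y) powr (-s) - (1 - s * y + s * (s + 1) / 2 * y\<^sup>2 - s * (s + 1) * (s + 2) / 6 * y ^ 3)\<bar> \<le> K * y ^ 4"
proof -
  define c where "c m = (\<Prod>i<m. - s - real i)" for m
  define diff where "diff m t = c m * (1 + t) powr (- s - real m)" for m t
  \<comment> \<open>The \<open>24\<close> is the factorial in the Lagrange remainder, and the power
    of 2 bounds \<open>(1 + t) powr (- s - 4)\<close> for \<open>t\<close> between -1/2 and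
    1/2.\<close>
  define K where "K = \<bar>c 4\<bar> / 24 * 2 powr \<bar>s + 4\<bar>"
  show ?thesis
  proof (rule that[of K])
    show "K \<ge> 0" by (simp add: K_def)
    fix y :: real assume y: "\<bar>y\<bar> \<le> 1/2"
    show "\<bar>(1 + y) powr (-s) - (1 - s * y + s * (s + 1) / 2 * y\<^sup>2 - s * (s + 1) * (s + 2) / 6 * y ^ 3)\<bar> \<le> K * y ^ 4"
    proof (cases "y = 0")
      case False
      have "\<exists>t. (if y < 0 then y < t \<and> t < 0 else 0 < t \<and> t < y) \<and>
          (1 + y) powr (-s) = (\<Sum>m<4. diff m 0 / fact m * (y - 0) ^ m) + diff 4 t / fact 4 * (y - 0) ^ 4"
      proof (rule Taylor[where a = "-1/2" and b = "1/2"])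
        show "diff 0 = (\<lambda>y. (1 + y) powr (-s))" by (simp add: diff_def c_def fun_eq_iff)
        show "\<forall>m t. m < 4 \<and> -1/2 \<le> t \<and> t \<le> 1/2 \<longrightarrow> DERIV (diff m) t :> diff (Suc m) t"
        proof (intro allI impI)
          fix m :: nat and t :: real assume "m < 4 \<and> -1/2 \<le> t \<and> t \<le> 1/2"
          then have "1 + t > 0" by simp
          moreover have "DERIV (\<lambda>t. 1 + t) t :> 1" by (auto intro!: derivative_eq_intros)
          ultimately have "DERIV (\<lambda>t. (1 + t) powr (- s - m)) t :> (- s - m) * (1 + t) powr (- s - m - 1)"
            using DERIV_fun_powr[of "\<lambda>t. 1 + t" 1 t "- s - m"] by simp
          from DERIV_cmult[OF this, of "c m"] show "DERIV (diff m) t :> diff (Suc m) t"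
            by (simp add: diff_def[abs_def] c_def algebra_simps)
        qed
      qed (use y False in auto)
      then obtain t where t: "(if y < 0 then y < t \<and> t < 0 else 0 < t \<and> t < y)"
        and eq: "(1 + y) powr (-s) = (\<Sum>m<4. diff m 0 / fact m * (y - 0) ^ m) + diff 4 t / fact 4 * (y - 0) ^ 4"
        by blast
      have t': "\<bar>t\<bar> \<le> 1/2" using t y by (auto split: if_splits)
      have "(\<Sum>m<4. diff m 0 / fact m * (y - 0) ^ m) =
          1 - s * y + s * (s + 1) / 2 * y\<^sup>2 - s * (s + 1) * (s + 2) / 6 * y ^ 3"
        by (simp add: diff_def c_def eval_nat_numeral) (simp add: field_simps)
      with eq have "\<bar>(1 + y) powr (-s) - (1 - s * y + s * (s + 1) / 2 * y\<^sup>2 - s * (s + 1) * (s + 2) / 6 * y ^ 3)\<bar> =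
          \<bar>diff 4 t\<bar> / 24 * y ^ 4"
        by (simp add: abs_mult fact_numeral)
      also have "\<bar>diff 4 t\<bar> \<le> \<bar>c 4\<bar> * 2 powr \<bar>s + 4\<bar>"
      proof -
        have "(1 + t) powr (- s - 4) \<le> 2 powr \<bar>s + 4\<bar>"
        proof -
          have "\<bar>ln (1 + t)\<bar> \<le> ln 2"
          proof -
            have "ln (1/2) \<le> ln (1 + t)" "ln (1 + t) \<le> ln 2" using t' by (auto simp: abs_le_iff)
            then show ?thesis by (simp add: ln_div)
          qed
          moreover have "\<bar>- s - 4\<bar> = \<bar>s + 4\<bar>" by arith
          ultimately have "\<bar>(- s - 4) * ln (1 + t)\<bar> \<le> \<bar>s + 4\<bar> * ln 2"
            by (simp add: abs_mult mult_left_mono)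
          then have "(- s - 4) * ln (1 + t) \<le> \<bar>s + 4\<bar> * ln 2" by linarith
          then show ?thesis using t' by (auto simp: powr_def)
        qed
        then show ?thesis by (simp add: diff_def abs_mult mult_left_mono)
      qed
      finally show ?thesis
        by (simp add: K_def mult_right_mono divide_right_mono mult.assoc)
    qed simp
  qed
qed

section \<open>The squared norm and the shifted potential\<close>

definition sq :: "int ^ 'd \<Rightarrow> real" where
  "sq x = (\<Sum>i\<in>UNIV. (of_int (x $ i))\<^sup>2)"

lemma sq_nonneg: "sq x \<ge> 0" by (simp add: sq_def sum_nonneg)

lemma sq_component: "(of_int (x $ i))\<^sup>2 \<le> sq x"
  unfolding sq_def by (rule member_le_sum) auto

lemma sq_0 [simp]: "sq 0 = 0" by (simp add: sq_def)

lemma sq_ge_1: "x \<noteq> 0 \<Longrightarrow> sq x \<ge> 1"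
proof -
  assume "x \<noteq> 0"
  then obtain i where i: "x $ i \<noteq> 0" by (auto simp: vec_eq_iff)
  then have "(x $ i)\<^sup>2 \<ge> 1" using zero_less_power2[of "x $ i"] by linarith
  then have "(of_int (x $ i) :: real)\<^sup>2 \<ge> 1"
    by (metis of_int_1_le_iff of_int_power)
  then show ?thesis using sq_component[of x i] by linarith
qed

lemma sq_add_axis: "sq (x + axis i c) = sq x + 2 * of_int c * of_int (x $ i) + (of_int c)\<^sup>2"
proof -
  have "sq (x + axis i c) = (\<Sum>j\<in>UNIV. (of_int (x $ j))\<^sup>2 + (if j = i then 2 * of_int c * of_int (x $ i) + (of_int c)\<^sup>2 else 0))"
    unfolding sq_def by (rule sum.cong) (auto simp: axis_def power2_eq_square algebra_simps)
  then show ?thesis by (simp add: sum.distrib sq_def)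
qed

lemma finite_sq_le: "finite {x :: int ^ 'd. sq x \<le> r}"
proof (rule finite_subset)
  define N where "N = \<lceil>r\<rceil>"
  show "finite (vec_lambda ` (Pi\<^sub>E (UNIV :: 'd set) (\<lambda>_. {- N..N})))"
    by (intro finite_imageI finite_PiE) auto
  show "{x :: int ^ 'd. sq x \<le> r} \<subseteq> vec_lambda ` (Pi\<^sub>E UNIV (\<lambda>_. {- N..N}))"
  proof
    fix x :: "int ^ 'd" assume x: "x \<in> {x. sq x \<le> r}"
    have "\<bar>x $ i\<bar> \<le> N" for i
    proof -
      have "\<bar>x $ i\<bar> \<le> (x $ i)\<^sup>2" using self_le_power[of "\<bar>x $ i\<bar>" 2] by (cases "x $ i = 0") auto
      then have "of_int \<bar>x $ i\<bar> \<le> (of_int (x $ i) :: real)\<^sup>2"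
        by (metis of_int_le_iff of_int_power)
      then have "of_int \<bar>x $ i\<bar> \<le> r" using sq_component[of x i] x by auto
      then show ?thesis unfolding N_def by linarith
    qed
    then have "x = vec_lambda (\<lambda>i. x $ i)" "(\<lambda>i. x $ i) \<in> Pi\<^sub>E UNIV (\<lambda>_. {- N..N})"
      by (auto simp: abs_le_iff) (smt (verit))+
    then show "x \<in> vec_lambda ` (Pi\<^sub>E UNIV (\<lambda>_. {- N..N}))" by blast
  qed
qed

text \<open>
  The coefficient \<open>s d (d/2 - 2a)\<close> comes from the continuous Laplacian of \<open>(|x|\<^sup>2 + a)\<^sup>-\<^sup>s\<close>
  at the critical exponent \<open>s = d/2 - 1\<close>. The discretisation error has the same order but is
  uniform in \<open>a\<close>, so for large \<open>|a|\<close> the sign of \<open>a\<close> decides between super- and subharmonicity.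
\<close>

lemma mean_potential:
  fixes s :: real
  assumes s: "s = real (CARD('d)) / 2 - 1"
  obtains K where
    "\<And>a (x :: int ^ 'd) v. v = sq x + a \<Longrightarrow> sq x \<le> 2 * v \<Longrightarrow> v \<ge> 36 \<Longrightarrow>
      \<bar>(2 * real (CARD('d)) + 1) * (mean (\<lambda>x. (sq x + a) powr (-s)) x - v powr (-s))
        - v powr (-s) * (s * CARD('d) * (CARD('d) / 2 - 2 * a)) / v\<^sup>2\<bar> \<le> v powr (-s) * K / v\<^sup>2"
proof -
  let ?d = "real (CARD('d))"
  obtain K where K: "K \<ge> 0" and Taylor: "\<And>y. \<bar>y\<bar> \<le> 1/2 \<Longrightarrow>
      \<bar>(1 + y) powr (-s) - (1 - s * y + s * (s + 1) / 2 * y\<^sup>2 - s * (s + 1) * (s + 2) / 6 * y ^ 3)\<bar> \<le> K * y ^ 4"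
    using powr_Taylor_4[of s] by blast
  define c where "c = s * (s + 1) * (s + 2) / 6"
  \<comment> \<open>The first summand bounds the cubic terms, by \<open>24 * u \<le> 48 * v\<close>.
    The second bounds the quartic remainder, where \<open>224 = 96 + 128\<close> comes from
    \<open>48 * u \<le> 96 * v\<^sup>2\<close> and
    \<open>32 * u\<^sup>2 \<le> 128 * v\<^sup>2\<close>.\<close>
  define K' where "K' = \<bar>c\<bar> * (2 * ?d + 48) + K * (2 * ?d + 224)"
  show ?thesis
  proof (rule that[of K'])
    fix a v :: real and x :: "int ^ 'd"
    assume v: "v = sq x + a" and uv: "sq x \<le> 2 * v" and v36: "v \<ge> 36"
    define w where "w i = (of_int (x $ i) :: real)" for i
    define u where "u = sq x"
    have u: "u = (\<Sum>i\<in>UNIV. (w i)\<^sup>2)" by (simp add: u_def sq_def w_def)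
    have u0: "u \<ge> 0" by (simp add: u sum_nonneg)
    define f where "f x = (sq x + a) powr (-s)" for x :: "int ^ 'd"
    define T where "T i = f (x + axis i 1) + f (x + axis i (-1)) - 2 * f x" for i
    \<comment> \<open>The cubic Taylor polynomials at the two opposite steps add up to
      \<open>2 + M i\<close>; the odd powers of \<open>w i\<close> cancel.\<close>
    define M where "M i = - 2 * s / v + s * (s + 1) / 2 * (2 + 8 * (w i)\<^sup>2) / v\<^sup>2 - c * (2 + 24 * (w i)\<^sup>2) / v ^ 3" for i
    have T: "\<bar>T i - v powr (-s) * M i\<bar> \<le> v powr (-s) * (K * (2 + 48 * (w i)\<^sup>2 + 32 * (w i) ^ 4) / v ^ 4)" for i
    proof -
      define p where "p y = 1 - s * y + s * (s + 1) / 2 * y\<^sup>2 - s * (s + 1) * (s + 2) / 6 * y ^ 3" for y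
      define y where "y \<sigma> = (1 + 2 * \<sigma> * w i) / v" for \<sigma>
      have f: "f (x + axis i \<sigma>) = v powr (-s) * (1 + y (of_int \<sigma>)) powr (-s)" "\<bar>y (of_int \<sigma>)\<bar> \<le> 1/2"
        if "\<sigma> = 1 \<or> \<sigma> = -1" for \<sigma>
      proof -
        \<comment> \<open>This gives \<open>1 + 2 * \<bar>w i\<bar> \<le> v / 4 + 9\<close>, which
          is at most \<open>v / 2\<close> exactly when \<open>v \<ge> 36\<close>: the origin of that
          threshold.\<close>
        have "(\<bar>w i\<bar> - 8)\<^sup>2 \<ge> 0" by simp
        then have "2 * \<bar>w i\<bar> \<le> (w i)\<^sup>2 / 8 + 8" by (simp add: power2_diff)
        also have "(w i)\<^sup>2 \<le> 2 * v" using sq_component[of x i] uv by (simp add: w_def)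
        finally have "1 + 2 * \<bar>w i\<bar> \<le> v / 2" using v36 by simp
        then have "\<bar>1 + 2 * w i\<bar> \<le> v / 2" "\<bar>1 - 2 * w i\<bar> \<le> v / 2" by linarith+
        then have "\<bar>1 + 2 * of_int \<sigma> * w i\<bar> \<le> v / 2" using that by auto
        then show y: "\<bar>y (of_int \<sigma>)\<bar> \<le> 1/2" using v36 by (simp add: y_def field_simps)
        have "sq (x + axis i \<sigma>) + a = v * (1 + y (of_int \<sigma>))"
          using v36 that by (auto simp: sq_add_axis v y_def w_def field_simps)
        then show "f (x + axis i \<sigma>) = v powr (-s) * (1 + y (of_int \<sigma>)) powr (-s)"
          using y v36 by (simp add: f_def powr_mult)
      qed
      have "T i - v powr (-s) * M i =
          v powr (-s) * (((1 + y 1) powr (-s) - p (y 1)) + ((1 + y (-1)) powr (-s) - p (y (-1))))"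
      proof -
        have "p (y 1) + p (y (-1)) = 2 + M i"
        proof -
          define q where "q = s * (s + 1) / 2"
          define r where "r = inverse v"
          have y: "y 1 = (1 + 2 * w i) * r" "y (-1) = (1 - 2 * w i) * r"
            by (simp_all add: y_def r_def divide_inverse)
          have M: "M i = - 2 * s * r + q * (2 + 8 * (w i)\<^sup>2) * r\<^sup>2 - c * (2 + 24 * (w i)\<^sup>2) * r ^ 3"
            by (simp only: M_def q_def r_def divide_inverse power_inverse)
          have p: "p y = 1 - s * y + q * y\<^sup>2 - c * y ^ 3" for y by (simp add: p_def q_def c_def)
          show ?thesis unfolding p y M by (simp add: power2_eq_square power3_eq_cube algebra_simps)
        qed
        moreover have "f x = v powr (-s)" by (simp add: f_def v)
        moreover have "f (x + axis i 1) = v powr (-s) * (1 + y 1) powr (-s)"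
          "f (x + axis i (-1)) = v powr (-s) * (1 + y (-1)) powr (-s)" using f(1)[of 1] f(1)[of "-1"] by auto
        ultimately show ?thesis by (simp add: T_def) algebra
      qed
      then have "\<bar>T i - v powr (-s) * M i\<bar> =
          v powr (-s) * \<bar>((1 + y 1) powr (-s) - p (y 1)) + ((1 + y (-1)) powr (-s) - p (y (-1)))\<bar>"
        by (simp add: abs_mult)
      also have "\<dots> \<le> v powr (-s) * (K * y 1 ^ 4 + K * y (-1) ^ 4)"
        using Taylor[of "y 1"] Taylor[of "y (-1)"] f(2)[of 1] f(2)[of "-1"]
        by (intro mult_left_mono) (auto simp: p_def)
      also have "K * y 1 ^ 4 + K * y (-1) ^ 4 = K * (2 + 48 * (w i)\<^sup>2 + 32 * (w i) ^ 4) / v ^ 4"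
        by (simp add: y_def power_divide add_divide_distrib[symmetric] distrib_left[symmetric])
           (simp add: power4_eq_xxxx power2_eq_square algebra_simps)
      finally show ?thesis .
    qed
    have mean: "(2 * ?d + 1) * (mean f x - v powr (-s)) = (\<Sum>i\<in>UNIV. T i)"
      by (simp add: mean_axis T_def sum.distrib sum_subtractf f_def v field_simps)
    have sumM: "(\<Sum>i\<in>UNIV. M i) = s * ?d * (?d / 2 - 2 * a) / v\<^sup>2 - c * (2 * ?d + 24 * u) / v ^ 3"
    proof -
      have "(\<Sum>i\<in>UNIV. M i) = - 2 * s * ?d / v + s * (s + 1) / 2 * (2 * ?d + 8 * u) / v\<^sup>2 - c * (2 * ?d + 24 * u) / v ^ 3"
        by (simp add: M_def u sum.distrib sum_subtractf sum_divide_distrib[symmetric] sum_distrib_left[symmetric])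
          (simp add: mult_ac)
      \<comment> \<open>The relation \<open>s + 1 = ?d / 2\<close> makes the contributions
        proportional to \<open>u\<close> cancel, which leaves only a constant over
        \<open>v\<^sup>2\<close>.\<close>
      also have "- 2 * s * ?d / v + s * (s + 1) / 2 * (2 * ?d + 8 * u) / v\<^sup>2 = s * ?d * (?d / 2 - 2 * a) / v\<^sup>2"
      proof -
        have "- 2 * s * ?d / v = - 2 * s * ?d * (u + a) / v\<^sup>2"
        proof -
          have "u + a = v" by (simp add: u_def v)
          then show ?thesis using v36 by (simp add: power2_eq_square)
        qed
        moreover have "s * (s + 1) / 2 * (2 * ?d + 8 * u) = s * ?d * (?d / 2 + 2 * u)"
        proof -
          have "s + 1 = ?d / 2" by (simp add: s)
          then show ?thesis by (simp only:) (simp add: field_simps)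
        qed
        moreover have "- 2 * s * ?d * (u + a) + s * ?d * (?d / 2 + 2 * u) = s * ?d * (?d / 2 - 2 * a)"
          by (simp add: algebra_simps)
        ultimately show ?thesis by (metis add_divide_distrib)
      qed
      finally show ?thesis .
    qed
    have w4: "(\<Sum>i\<in>UNIV. (w i) ^ 4) \<le> u\<^sup>2"
    proof -
      have "(\<Sum>i\<in>UNIV. (w i) ^ 4) \<le> (\<Sum>i\<in>UNIV. (w i)\<^sup>2 * u)"
      proof (rule sum_mono)
        fix i
        have "(w i)\<^sup>2 \<le> u" using sq_component[of x i] by (simp add: w_def u_def)
        then have "(w i)\<^sup>2 * (w i)\<^sup>2 \<le> (w i)\<^sup>2 * u" by (intro mult_left_mono) auto
        then show "(w i) ^ 4 \<le> (w i)\<^sup>2 * u" by (simp add: power4_eq_xxxx power2_eq_square mult.assoc)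
      qed
      also have "\<dots> = u\<^sup>2"
        by (simp only: sum_distrib_right[symmetric] u[symmetric]) (simp add: power2_eq_square)
      finally show ?thesis .
    qed
    have "\<bar>(\<Sum>i\<in>UNIV. T i) - v powr (-s) * (\<Sum>i\<in>UNIV. M i)\<bar> \<le> (\<Sum>i\<in>UNIV. \<bar>T i - v powr (-s) * M i\<bar>)"
      by (simp add: sum_distrib_left sum_subtractf[symmetric])
    also have "\<dots> \<le> (\<Sum>i\<in>UNIV. v powr (-s) * (K * (2 + 48 * (w i)\<^sup>2 + 32 * (w i) ^ 4) / v ^ 4))"
      by (rule sum_mono) (rule T)
    also have "\<dots> = v powr (-s) * (K * (2 * ?d + 48 * u + 32 * (\<Sum>i\<in>UNIV. (w i) ^ 4)) / v ^ 4)"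
      by (simp add: sum_distrib_left[symmetric] sum_divide_distrib[symmetric] sum.distrib u)
    also have "\<dots> \<le> v powr (-s) * (K * (2 * ?d + 224) / v\<^sup>2)"
    proof (intro mult_left_mono)
      have "2 * ?d + 48 * u + 32 * (\<Sum>i\<in>UNIV. (w i) ^ 4) \<le> 2 * ?d * v\<^sup>2 + 96 * v\<^sup>2 + 128 * v\<^sup>2"
      proof -
        have "1 \<le> v" "v \<le> v\<^sup>2" "1 \<le> v\<^sup>2" using v36 by (auto intro: self_le_power one_le_power)
        moreover have "?d \<le> ?d * v\<^sup>2" using \<open>1 \<le> v\<^sup>2\<close> mult_left_mono[of 1 "v\<^sup>2" ?d] by simp
        moreover have "u\<^sup>2 \<le> (2 * v)\<^sup>2" using uv u0 by (intro power_mono) (auto simp: u_def)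
        then have "u\<^sup>2 \<le> 4 * v\<^sup>2" by (simp add: power_mult_distrib)
        moreover have "u \<le> 2 * v" using uv by (simp add: u_def)
        ultimately show ?thesis using w4 by linarith
      qed
      then have "K * (2 * ?d + 48 * u + 32 * (\<Sum>i\<in>UNIV. (w i) ^ 4)) / v ^ 4 \<le> K * (2 * ?d * v\<^sup>2 + 96 * v\<^sup>2 + 128 * v\<^sup>2) / v ^ 4"
        using K by (intro divide_right_mono mult_left_mono) auto
      also have "\<dots> = K * (2 * ?d + 224) / v\<^sup>2"
        using v36 by (simp add: power4_eq_xxxx power2_eq_square field_simps)
      finally show "K * (2 * ?d + 48 * u + 32 * (\<Sum>i\<in>UNIV. (w i) ^ 4)) / v ^ 4 \<le> K * (2 * ?d + 224) / v\<^sup>2" .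
    qed simp
    finally have e1: "\<bar>(\<Sum>i\<in>UNIV. T i) - v powr (-s) * (\<Sum>i\<in>UNIV. M i)\<bar> \<le> v powr (-s) * (K * (2 * ?d + 224) / v\<^sup>2)" .
    have "\<bar>c * (2 * ?d + 24 * u) / v ^ 3\<bar> \<le> \<bar>c\<bar> * (2 * ?d + 48) / v\<^sup>2"
    proof -
      have "2 * ?d + 24 * u \<le> 2 * ?d * v + 48 * v"
      proof -
        have "?d \<le> ?d * v" using v36 mult_left_mono[of 1 v ?d] by simp
        moreover have "u \<le> 2 * v" using uv by (simp add: u_def)
        ultimately show ?thesis by linarith
      qed
      then have "\<bar>c\<bar> * (2 * ?d + 24 * u) / v ^ 3 \<le> \<bar>c\<bar> * (2 * ?d * v + 48 * v) / v ^ 3"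
        using v36 by (intro divide_right_mono mult_left_mono) auto
      also have "\<dots> = \<bar>c\<bar> * (2 * ?d + 48) / v\<^sup>2"
        using v36 by (simp add: power3_eq_cube power2_eq_square field_simps)
      finally show ?thesis using v36 u0 by (simp add: abs_mult)
    qed
    then have "v powr (-s) * \<bar>c * (2 * ?d + 24 * u) / v ^ 3\<bar> \<le> v powr (-s) * (\<bar>c\<bar> * (2 * ?d + 48) / v\<^sup>2)"
      by (rule mult_left_mono) simp
    then have e2: "\<bar>v powr (-s) * (c * (2 * ?d + 24 * u) / v ^ 3)\<bar> \<le> v powr (-s) * (\<bar>c\<bar> * (2 * ?d + 48) / v\<^sup>2)"
      by (simp add: abs_mult)
    have "v powr (-s) * K' / v\<^sup>2 = v powr (-s) * (K * (2 * ?d + 224) / v\<^sup>2) + v powr (-s) * (\<bar>c\<bar> * (2 * ?d + 48) / v\<^sup>2)"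
      by (simp add: K'_def algebra_simps add_divide_distrib)
    moreover have "v powr (-s) * (\<Sum>i\<in>UNIV. M i) =
        v powr (-s) * (s * ?d * (?d / 2 - 2 * a)) / v\<^sup>2 - v powr (-s) * (c * (2 * ?d + 24 * u) / v ^ 3)"
      by (simp only: sumM right_diff_distrib times_divide_eq_right)
    ultimately have "\<bar>(2 * ?d + 1) * (mean f x - v powr (-s)) - v powr (-s) * (s * ?d * (?d / 2 - 2 * a)) / v\<^sup>2\<bar>
        \<le> v powr (-s) * K' / v\<^sup>2"
      using e1 e2 unfolding mean by linarith
    then show "\<bar>(2 * real (CARD('d)) + 1) * (mean (\<lambda>x. (sq x + a) powr (-s)) x - v powr (-s))
        - v powr (-s) * (s * CARD('d) * (CARD('d) / 2 - 2 * a)) / v\<^sup>2\<bar> \<le> v powr (-s) * K' / v\<^sup>2"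
      by (simp add: f_def[abs_def])
  qed
qed

subsection \<open>Two-sided bounds for hitting probabilities\<close>

text \<open>For a large enough shift \<open>A\<close> the main term of \<open>mean_potential\<close>
  outweighs its error. The shift by \<open>A\<close> makes it negative and the shift by
  \<open>- A\<close> positive; in the second case \<open>sq x \<ge> 2 * A\<close> is what
  \<open>sq x \<le> 2 * v\<close> demands.\<close>

lemma superharmonic_potential:
  assumes "CARD('d::finite) \<ge> 3" and s: "s = real (CARD('d)) / 2 - 1"
  obtains A where "A \<ge> 36"
    "\<And>x :: int ^ 'd. mean (\<lambda>x. (sq x + A) powr (-s)) x \<le> (sq x + A) powr (-s)"
    "\<And>x :: int ^ 'd. sq x \<ge> 2 * A \<Longrightarrow> (sq x - A) powr (-s) \<le> mean (\<lambda>x. (sq x - A) powr (-s)) x"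
proof -
  let ?d = "real (CARD('d))"
  have s0: "s > 0" using assms by simp
  obtain K where K: "\<And>a (x :: int ^ 'd) v. v = sq x + a \<Longrightarrow> sq x \<le> 2 * v \<Longrightarrow> v \<ge> 36 \<Longrightarrow>
      \<bar>(2 * real (CARD('d)) + 1) * (mean (\<lambda>x. (sq x + a) powr (-s)) x - v powr (-s))
        - v powr (-s) * (s * CARD('d) * (CARD('d) / 2 - 2 * a)) / v\<^sup>2\<bar> \<le> v powr (-s) * K / v\<^sup>2"
    using mean_potential[OF s] by metis
  \<comment> \<open>The value 36 secures the condition on \<open>v\<close>, and the other entry
    secures \<open>\<bar>K\<bar> \<le> s * ?d * (2 * A - ?d / 2)\<close>.\<close>
  define A where "A = max 36 (\<bar>K\<bar> / (s * ?d) + ?d)"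
  have "s * ?d > 0" using s0 by simp
  then have KA: "\<bar>K\<bar> \<le> s * ?d * (2 * A - ?d / 2)"
  proof -
    have "\<bar>K\<bar> / (s * ?d) \<le> 2 * A - ?d / 2"
    proof -
      have "\<bar>K\<bar> / (s * ?d) \<ge> 0" using \<open>s * ?d > 0\<close> by (intro divide_nonneg_nonneg) auto
      moreover have "\<bar>K\<bar> / (s * ?d) + ?d \<le> A" by (simp add: A_def)
      moreover have "?d \<ge> 0" by simp
      ultimately show ?thesis by argo
    qed
    then show ?thesis using \<open>s * ?d > 0\<close> by (simp add: pos_divide_le_eq mult.commute)
  qed
  have A36: "A \<ge> 36" by (simp add: A_def)
  show ?thesis
  proof (rule that[OF A36])
    fix x :: "int ^ 'd"
    let ?v = "sq x + A"
    have v: "?v \<ge> 36" "sq x \<le> 2 * ?v" using A36 sq_nonneg[of x] by auto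
    have "?v powr (-s) * (K + s * ?d * (?d / 2 - 2 * A)) / ?v\<^sup>2 \<le> 0"
      using KA by (intro divide_nonpos_nonneg mult_nonneg_nonpos) (auto simp: algebra_simps)
    then have "?v powr (-s) * K / ?v\<^sup>2 + ?v powr (-s) * (s * ?d * (?d / 2 - 2 * A)) / ?v\<^sup>2 \<le> 0"
      by (simp only: distrib_left add_divide_distrib)
    with K[OF refl v(2,1)] have "(2 * ?d + 1) * (mean (\<lambda>x. (sq x + A) powr (-s)) x - ?v powr (-s)) \<le> 0"
      by linarith
    then show "mean (\<lambda>x. (sq x + A) powr (-s)) x \<le> ?v powr (-s)"
      by (simp add: mult_le_0_iff)
  next
    fix x :: "int ^ 'd" assume x: "sq x \<ge> 2 * A"
    let ?v = "sq x + (- A)"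
    have v: "?v \<ge> 36" "sq x \<le> 2 * ?v" using A36 x by auto
    have "s * ?d * (2 * A - ?d / 2) \<le> s * ?d * (?d / 2 + 2 * A)"
      using \<open>s * ?d > 0\<close> by (intro mult_left_mono) auto
    then have "?v powr (-s) * (s * ?d * (?d / 2 - 2 * (- A)) - K) / ?v\<^sup>2 \<ge> 0"
      using KA by (intro divide_nonneg_nonneg mult_nonneg_nonneg) auto
    then have "?v powr (-s) * (s * ?d * (?d / 2 - 2 * (- A))) / ?v\<^sup>2 - ?v powr (-s) * K / ?v\<^sup>2 \<ge> 0"
      by (simp only: right_diff_distrib diff_divide_distrib)
    with K[OF refl v(2,1)] have "(2 * ?d + 1) * (mean (\<lambda>x. (sq x + (- A)) powr (-s)) x - ?v powr (-s)) \<ge> 0"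
      by linarith
    then show "(sq x - A) powr (-s) \<le> mean (\<lambda>x. (sq x - A) powr (-s)) x"
      by (simp add: zero_le_mult_iff)
  qed
qed

text \<open>The upper bound compares \<open>hit0\<close> with the superharmonic potential,
  normalised by its value at the origin. The lower bound compares it with a multiple of the
  subharmonic potential, replaced near the origin by a constant.\<close>

lemma hit0_bounds:
  assumes d3: "CARD('d::finite) \<ge> 3" and s: "s = real (CARD('d)) / 2 - 1"
  obtains c C where "c > 0" "C > 0"
    "\<And>x :: int ^ 'd. x \<noteq> 0 \<Longrightarrow> c * sq x powr (-s) \<le> hit0 x"
    "\<And>x :: int ^ 'd. x \<noteq> 0 \<Longrightarrow> hit0 x \<le> C * sq x powr (-s)"
proof -
  have s0: "s > 0" using assms by simp
  obtain A where A36: "A \<ge> 36" and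
    super: "\<And>x :: int ^ 'd. mean (\<lambda>x. (sq x + A) powr (-s)) x \<le> (sq x + A) powr (-s)" and
    sub: "\<And>x :: int ^ 'd. sq x \<ge> 2 * A \<Longrightarrow> (sq x - A) powr (-s) \<le> mean (\<lambda>x. (sq x - A) powr (-s)) x"
    using superharmonic_potential[OF assms] by blast
  have upper: "hit0 x \<le> A powr s * sq x powr (-s)" if "x \<noteq> 0" for x :: "int ^ 'd"
  proof -
    have "hit0 x * (sq (0 :: int ^ 'd) + A) powr (-s) \<le> (sq x + A) powr (-s)"
      by (rule hit0_le_superharmonic[where f = "\<lambda>x. (sq x + A) powr (-s)"]) (simp_all add: super)
    also have "\<dots> \<le> sq x powr (-s)"
      using A36 sq_ge_1[OF that] s0 by (intro powr_mono2') auto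
    finally show ?thesis using A36 by (simp add: powr_minus field_simps)
  qed
  have transient: "(\<lambda>n. (mean ^^ n) (\<lambda>z. of_bool (z = y)) x) \<longlonglongrightarrow> 0" for x y :: "int ^ 'd"
  proof (rule mean_funpow_tendsto_0)
    let ?f = "\<lambda>x. (sq (x - y) + A) powr (-s)"
    have tr: "mean ?f x = mean (\<lambda>x. (sq x + A) powr (-s)) (x - y)" for x
      by (rule mean_translate)
    show "?f x \<ge> 0" for x by simp
    show "mean ?f x \<le> ?f x" for x unfolding tr by (rule super)
    \<comment> \<open>All nonzero steps from \<open>y\<close> lead to squared distance 1, so the
      average of the potential drops strictly at its pole.\<close>
    have "(1 + A) powr (-s) < A powr (-s)"
      using A36 s0 by (intro powr_less_mono2_neg) auto
    then show "mean ?f y < ?f y"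
      unfolding tr using sq_add_axis[of "0 :: int ^ 'd" _ 1] sq_add_axis[of "0 :: int ^ 'd" _ "-1"]
      by (simp add: mean_axis field_simps)
  qed
  \<comment> \<open>The radius leaves room for one step: outside \<open>K\<close> every neighbour
    has \<open>sq\<close> at least \<open>sq x / 2 - 2\<close>, hence at least \<open>2 * A\<close>,
    and only the potential branch of \<open>g\<close> is seen.\<close>
  define K where "K = {x :: int ^ 'd. sq x \<le> 4 * A + 4}"
  have K: "finite K" "0 \<in> K" using A36 finite_sq_le by (auto simp: K_def)
  define \<kappa> where "\<kappa> = Min (hit0 ` K)"
  have \<kappa>: "\<kappa> > 0" "\<And>x. x \<in> K \<Longrightarrow> \<kappa> \<le> hit0 x"
  proof -
    show "\<kappa> > 0" unfolding \<kappa>_def using K hit0_pos by (subst Min_gr_iff) auto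
  qed (use K in \<open>auto simp: \<kappa>_def\<close>)
  \<comment> \<open>The factor \<open>A powr s\<close> makes the potential branch equal to
    \<open>\<kappa>\<close> at \<open>sq x = 2 * A\<close> and at most \<open>\<kappa>\<close>
    beyond.\<close>
  define g where "g x = (if sq x \<ge> 2 * A then \<kappa> * A powr s * (sq x - A) powr (-s) else \<kappa>)" for x :: "int ^ 'd"
  have g_le: "g x \<le> \<kappa>" for x
  proof -
    have "(sq x - A) powr (-s) \<le> A powr (-s)" if "sq x \<ge> 2 * A"
      using A36 that s0 by (intro powr_mono2') auto
    then have "A powr s * (sq x - A) powr (-s) \<le> A powr s * A powr (-s)" if "sq x \<ge> 2 * A"
      using that by (intro mult_left_mono) auto
    also have "A powr s * A powr (-s) = 1" using A36 by (simp add: powr_minus)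
    finally show ?thesis using \<kappa>(1) by (auto simp: g_def mult.assoc)
  qed
  have g: "g x \<le> hit0 x" for x
  proof (rule subharmonic_le_hit0[OF _ K(2) _ _ transient])
    show "g x \<le> hit0 x" if "x \<in> K" for x using \<kappa>(2)[OF that] g_le[of x] by simp
  next
    fix x :: "int ^ 'd" assume "x \<notin> K"
    then have x: "sq x > 4 * A + 4" by (simp add: K_def)
    have near: "sq (x + e) \<ge> 2 * A" if "l1_norm e \<le> 1" for e
    proof -
      have "e \<in> insert 0 (range (\<lambda>i. axis i 1) \<union> range (\<lambda>i. axis i (-1)))"
        using that l1_ball_eq by blast
      then consider "e = 0" | i \<sigma> where "e = axis i \<sigma>" "\<sigma> = 1 \<or> \<sigma> = -1" by auto
      then show ?thesis
      proof cases
        case 1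
        then show ?thesis using x A36 by simp
      next
        case 2
        have "(\<bar>of_int (x $ i)\<bar> - 2 :: real)\<^sup>2 \<ge> 0" by simp
        then have "2 * \<bar>of_int (x $ i)\<bar> \<le> (of_int (x $ i) :: real)\<^sup>2 / 2 + 2" by (simp add: power2_diff)
        also have "(of_int (x $ i) :: real)\<^sup>2 \<le> sq x" by (rule sq_component)
        finally have "2 * \<bar>of_int (x $ i)\<bar> \<le> sq x / 2 + 2" by simp
        moreover have "sq (x + e) \<ge> sq x - 2 * \<bar>of_int (x $ i)\<bar>"
          using 2 by (auto simp: sq_add_axis)
        ultimately show ?thesis using x by linarith
      qed
    qed
    have "l1_norm (0 :: int ^ 'd) \<le> 1" by (simp add: l1_norm_def)
    from near[OF this] have x2: "sq x \<ge> 2 * A" by simp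
    have "mean g x = mean (\<lambda>x. \<kappa> * A powr s * (sq x - A) powr (-s)) x"
      using near by (auto simp: mean_def g_def intro!: sum.cong)
    also have "\<dots> = \<kappa> * A powr s * mean (\<lambda>x. (sq x - A) powr (-s)) x" by (rule mean_cmult)
    also have "\<dots> \<ge> \<kappa> * A powr s * (sq x - A) powr (-s)"
      using sub[OF x2] \<kappa>(1) by (intro mult_left_mono) auto
    finally show "g x \<le> mean g x" using x2 by (simp add: g_def)
  next
    fix \<epsilon> :: real assume \<epsilon>: "\<epsilon> > 0"
    \<comment> \<open>The first summand is where the potential branch falls to
      \<open>\<epsilon>\<close>; adding \<open>2 * A\<close> ensures that this branch
      applies.\<close>
    define r where "r = (\<kappa> * A powr s / \<epsilon>) powr (1 / s) + 2 * A"
    have "sq x \<le> r + A" if "g x > \<epsilon>" for x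
    proof (rule ccontr)
      assume "\<not> sq x \<le> r + A"
      then have xr: "sq x - A > r" by simp
      have r: "r \<ge> 2 * A" by (simp add: r_def)
      have "(\<kappa> * A powr s / \<epsilon>) = ((\<kappa> * A powr s / \<epsilon>) powr (1 / s)) powr s"
        using \<kappa>(1) \<epsilon> s0 A36 by (simp add: powr_powr)
      also have "\<dots> \<le> (sq x - A) powr s"
        using xr A36 s0 by (intro powr_mono2) (auto simp: r_def)
      finally have "\<kappa> * A powr s / \<epsilon> \<le> (sq x - A) powr s" .
      moreover have "(sq x - A) powr s > 0" using xr r A36 by simp
      ultimately have "\<kappa> * A powr s * (sq x - A) powr (-s) \<le> \<epsilon>"
        using \<epsilon> by (simp add: powr_minus field_simps)
      then show False using that xr r A36 by (simp add: g_def)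
    qed
    then have "{x. g x > \<epsilon>} \<subseteq> {x. sq x \<le> r + A}" by auto
    then show "finite {x. g x > \<epsilon>}" using finite_sq_le finite_subset by blast
  qed
  have lower: "\<kappa> * sq x powr (-s) \<le> hit0 x" if "x \<noteq> 0" for x :: "int ^ 'd"
  proof (cases "sq x \<ge> 2 * A")
    case True
    have "A powr s \<ge> 1" using A36 s0 by (intro ge_one_powr_ge_zero) auto
    moreover have "sq x powr (-s) \<le> (sq x - A) powr (-s)"
      using A36 True s0 by (intro powr_mono2') auto
    ultimately have "1 * sq x powr (-s) \<le> A powr s * (sq x - A) powr (-s)" by (intro mult_mono) auto
    then have "\<kappa> * sq x powr (-s) \<le> g x" using \<kappa>(1) True by (simp add: g_def mult.assoc)
    then show ?thesis using g[of x] by simp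
  next
    case False
    have "sq x powr (-s) \<le> sq x powr 0" using sq_ge_1[OF that] s0 by (intro powr_mono) auto
    also have "\<dots> = 1" using sq_ge_1[OF that] by simp
    finally have "\<kappa> * sq x powr (-s) \<le> \<kappa>" using \<kappa>(1) by simp
    also have "\<kappa> = g x" using False by (simp add: g_def)
    finally show ?thesis using g[of x] by simp
  qed
  show ?thesis by (rule that[OF \<kappa>(1) _ lower upper]) (use A36 in auto)
qed

text \<open>Through \<open>L2_set\<close> this inherits the triangle inequality, on which the
  passage from trees to paths rests.\<close>

definition eucl :: "int ^ 'd \<Rightarrow> int ^ 'd \<Rightarrow> real" where
  "eucl x y = L2_set (\<lambda>i. of_int (x $ i) - of_int (y $ i)) UNIV"

lemma eucl_nonneg: "eucl x y \<ge> 0" by (simp add: eucl_def L2_set_nonneg)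

lemma eucl_commute: "eucl x y = eucl y x"
  unfolding eucl_def L2_set_def by (simp add: power2_commute)

lemma eucl_triangle: "eucl x z \<le> eucl x y + eucl y z"
proof -
  have "eucl x z = L2_set (\<lambda>i. (of_int (x $ i) - of_int (y $ i)) + (of_int (y $ i) - of_int (z $ i))) UNIV"
    by (simp add: eucl_def)
  also have "\<dots> \<le> eucl x y + eucl y z" unfolding eucl_def by (rule L2_set_triangle_ineq)
  finally show ?thesis .
qed

lemma eucl_sq: "eucl x y = sqrt (sq (x - y))"
  by (simp add: eucl_def L2_set_def sq_def)

lemma eucl_pos: "x \<noteq> y \<Longrightarrow> eucl x y > 0"
  using sq_ge_1[of "x - y"] by (simp add: eucl_sq)

text \<open>Since \<open>2 * s = d - 2\<close>, the real power of \<open>sq\<close> is a natural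
  power of the distance.\<close>

lemma hit_bounds:
  assumes d3: "CARD('d::finite) \<ge> 3"
  obtains c C where "c > 0" "C > 0"
    "\<And>x y :: int ^ 'd. x \<noteq> y \<Longrightarrow> c / eucl x y ^ (CARD('d) - 2) \<le> hit x y"
    "\<And>x y :: int ^ 'd. x \<noteq> y \<Longrightarrow> hit x y \<le> C / eucl x y ^ (CARD('d) - 2)"
proof -
  define s where "s = real (CARD('d)) / 2 - 1"
  obtain c C where cC: "c > 0" "C > 0"
    "\<And>x :: int ^ 'd. x \<noteq> 0 \<Longrightarrow> c * sq x powr (-s) \<le> hit0 x"
    "\<And>x :: int ^ 'd. x \<noteq> 0 \<Longrightarrow> hit0 x \<le> C * sq x powr (-s)"
    using hit0_bounds[OF d3 s_def] by metis
  have eq: "a * sq (x - y) powr (-s) = a / eucl x y ^ (CARD('d) - 2)" if "x \<noteq> y" for a and x y :: "int ^ 'd"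
  proof -
    have pos: "sq (x - y) > 0" using sq_ge_1[of "x - y"] that by simp
    have "eucl x y ^ (CARD('d) - 2) = (sq (x - y) powr (1/2)) powr real (CARD('d) - 2)"
      using pos by (simp add: eucl_sq powr_realpow[symmetric] powr_half_sqrt)
    also have "\<dots> = sq (x - y) powr s"
      using d3 by (simp add: powr_powr s_def of_nat_diff diff_divide_distrib)
    finally show ?thesis by (simp add: powr_minus divide_inverse)
  qed
  show ?thesis
  proof (rule that[OF cC(1,2)])
    fix x y :: "int ^ 'd" assume "x \<noteq> y"
    then show "c / eucl x y ^ (CARD('d) - 2) \<le> hit x y" "hit x y \<le> C / eucl x y ^ (CARD('d) - 2)"
      using cC(3,4)[of "x - y"] by (simp_all add: eq hit_eq_hit0)
  qed
qed

subsection \<open>From trees to Hamiltonian paths\<close>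

fun chain_prod :: "('a \<Rightarrow> 'a \<Rightarrow> real) \<Rightarrow> 'a list \<Rightarrow> real" where
  "chain_prod D (x # y # xs) = D x y * chain_prod D (y # xs)"
| "chain_prod D _ = 1"

lemma chain_prod_append:
  "xs \<noteq> [] \<Longrightarrow> ys \<noteq> [] \<Longrightarrow>
    chain_prod D (xs @ ys) = chain_prod D xs * D (last xs) (hd ys) * chain_prod D ys"
proof (induction xs rule: induct_list012)
  case (2 x)
  then show ?case by (cases ys) auto
qed auto

lemma chain_prod_nonneg: "(\<And>x y. D x y \<ge> 0) \<Longrightarrow> chain_prod D xs \<ge> 0"
  by (induction D xs rule: chain_prod.induct) auto

text \<open>A rank that falls from child to parent encodes the tree. The number of vertices of
  smaller rank bounds the depth of a vertex, and each edge towards the root costs at most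
  \<open>M\<close>.\<close>

lemma tree_dist_root_le:
  fixes D :: "'a \<Rightarrow> 'a \<Rightarrow> real" and rk :: "'a \<Rightarrow> nat"
  assumes refl: "\<And>x. D x x = 0" and tri: "\<And>x y z. D x z \<le> D x y + D y z"
    and V: "finite V" and M: "M \<ge> 0"
    and par: "\<And>v. v \<in> V - {r} \<Longrightarrow> par v \<in> V" "\<And>v. v \<in> V - {r} \<Longrightarrow> rk (par v) < rk v"
    and edge: "\<And>v. v \<in> V - {r} \<Longrightarrow> D (par v) v \<le> M"
    and "x \<in> V"
  shows "D r x \<le> M * real (card V - 1)"
proof -
  have *: "x \<in> V \<Longrightarrow> D r x \<le> M * card {v\<in>V. rk v < rk x}" for x
  proof (induction "rk x" arbitrary: x rule: less_induct)
    case less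
    show ?case
    proof (cases "x = r")
      case False
      then have x: "x \<in> V - {r}" using less by simp
      have "card {v\<in>V. rk v < rk (par x)} < card {v\<in>V. rk v < rk x}"
        using V par[OF x] by (intro psubset_card_mono) auto
      then have "real (card {v\<in>V. rk v < rk (par x)}) + 1 \<le> card {v\<in>V. rk v < rk x}" by simp
      then have "M * (card {v\<in>V. rk v < rk (par x)} + 1) \<le> M * card {v\<in>V. rk v < rk x}"
        using M by (intro mult_left_mono) auto
      moreover have "D r (par x) \<le> M * card {v\<in>V. rk v < rk (par x)}"
        using less.hyps[OF par(2)[OF x] par(1)[OF x]] .
      ultimately show ?thesis using tri[of r x "par x"] edge[OF x] by (simp add: algebra_simps)
    qed (simp add: refl M)
  qed
  have "{v\<in>V. rk v < rk x} \<subseteq> V - {x}" by auto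
  then have "card {v\<in>V. rk v < rk x} \<le> card V - 1"
    using card_mono[of "V - {x}"] V \<open>x \<in> V\<close> by auto
  then have "M * card {v\<in>V. rk v < rk x} \<le> M * real (card V - 1)"
    using M by (intro mult_left_mono) auto
  with *[OF \<open>x \<in> V\<close>] show ?thesis by linarith
qed

text \<open>
  Delete a longest edge and concatenate the paths of the two subtrees. The new step is at most
  twice the number of edges times that edge.
\<close>

lemma tree_to_path:
  fixes D :: "'a \<Rightarrow> 'a \<Rightarrow> real" and rk :: "'a \<Rightarrow> nat"
  assumes nonneg: "\<And>x y. D x y \<ge> 0" and refl: "\<And>x. D x x = 0"
    and comm: "\<And>x y. D x y = D y x" and tri: "\<And>x y z. D x z \<le> D x y + D y z"
    and "finite V" "r \<in> V"
    and "\<And>v. v \<in> V - {r} \<Longrightarrow> par v \<in> V" "\<And>v. v \<in> V - {r} \<Longrightarrow> rk (par v) < rk v"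
  obtains xs where "distinct (r # xs)" "set (r # xs) = V"
    "chain_prod D (r # xs) \<le> 2 ^ (card V - 1) * fact (card V - 1) * (\<Prod>v\<in>V - {r}. D (par v) v)"
proof -
  have "\<exists>xs. distinct (r # xs) \<and> set (r # xs) = V \<and>
      chain_prod D (r # xs) \<le> 2 ^ (card V - 1) * fact (card V - 1) * (\<Prod>v\<in>V - {r}. D (par v) v)"
    using assms(5-)
  proof (induction "card V" arbitrary: V r rule: less_induct)
    case less
    note V = \<open>finite V\<close> and r = \<open>r \<in> V\<close> and par = less.prems(3) and rk = less.prems(4)
    show ?case
    proof (cases "V = {r}")
      case True
      then show ?thesis by (intro exI[of _ "[]"]) auto
    next
      case False
      let ?E = "\<lambda>v. D (par v) v"
      have ne: "V - {r} \<noteq> {}" using False r by auto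
      define M where "M = Max (?E ` (V - {r}))"
      have "M \<in> ?E ` (V - {r})" unfolding M_def using V ne by (intro Max_in) auto
      then obtain b where b: "b \<in> V - {r}" and M: "M = ?E b" by auto
      have edge: "?E v \<le> M" if "v \<in> V - {r}" for v unfolding M_def using V that by (intro Max_ge) auto
      define R where "R = {(v, par v) | v. v \<in> V - {r}}"
      \<comment> \<open>\<open>R\<close> leads from child to parent, so \<open>B\<close> is the
        subtree hanging from \<open>b\<close>. It is a tree with root \<open>b\<close>, and its
        complement \<open>A\<close> is a tree with root \<open>r\<close>.\<close>
      define B where "B = {v\<in>V. (v, b) \<in> R\<^sup>*}"
      define A where "A = V - B"
      have bB: "b \<in> B" using b by (simp add: B_def)
      have rB: "r \<notin> B"
      proof
        assume "r \<in> B"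
        then have "(r, b) \<in> R\<^sup>*" by (simp add: B_def)
        then show False using b by (cases rule: converse_rtranclE) (auto simp: R_def)
      qed
      have parB: "par v \<in> B" if "v \<in> B - {b}" for v
      proof -
        have "(v, b) \<in> R\<^sup>*" "v \<noteq> b" using that by (auto simp: B_def)
        then obtain u where "(v, u) \<in> R" "(u, b) \<in> R\<^sup>*" by (meson converse_rtranclE)
        then show ?thesis using par by (auto simp: R_def B_def)
      qed
      have parA: "par v \<in> A" if "v \<in> A - {r}" for v
      proof -
        have v: "v \<in> V - {r}" using that by (auto simp: A_def)
        have "(v, b) \<in> R\<^sup>*" if "(par v, b) \<in> R\<^sup>*"
          using v that by (intro converse_rtrancl_into_rtrancl[of v "par v"]) (auto simp: R_def)
        then show ?thesis using that par[OF v] v by (auto simp: A_def B_def)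
      qed
      have fin: "finite A" "finite B" and AB: "A \<union> B = V" "A \<inter> B = {}"
        using V by (auto simp: A_def B_def)
      have rA: "r \<in> A" using r rB by (simp add: A_def)
      have card: "card V = card A + card B" using card_Un_disjoint[OF fin AB(2)] AB(1) by simp
      have cA: "card A \<ge> 1" and cB: "card B \<ge> 1"
        using fin rA bB by (auto simp: Suc_le_eq card_gt_0_iff)
      have "\<exists>xs. distinct (r # xs) \<and> set (r # xs) = A \<and>
          chain_prod D (r # xs) \<le> 2 ^ (card A - 1) * fact (card A - 1) * (\<Prod>v\<in>A - {r}. ?E v)"
        using card cB fin rA parA rk by (intro less.hyps) (auto simp: A_def)
      then obtain as where as: "distinct (r # as)" "set (r # as) = A"
        "chain_prod D (r # as) \<le> 2 ^ (card A - 1) * fact (card A - 1) * (\<Prod>v\<in>A - {r}. ?E v)" by blast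
      have "\<exists>xs. distinct (b # xs) \<and> set (b # xs) = B \<and>
          chain_prod D (b # xs) \<le> 2 ^ (card B - 1) * fact (card B - 1) * (\<Prod>v\<in>B - {b}. ?E v)"
        using card cA fin bB parB rk rB by (intro less.hyps) (auto simp: B_def)
      then obtain bs where bs: "distinct (b # bs)" "set (b # bs) = B"
        "chain_prod D (b # bs) \<le> 2 ^ (card B - 1) * fact (card B - 1) * (\<Prod>v\<in>B - {b}. ?E v)" by blast
      define l where "l = last (r # as)"
      have l: "l \<in> A" using as(2) last_in_set[of "r # as"] by (simp add: l_def)
      have parb: "par b \<in> A"
      proof -
        \<comment> \<open>Ranks never increase along \<open>R\<close>, so no chain leads from
          \<open>par b\<close> to its child \<open>b\<close>.\<close>
        have "(par b, b) \<notin> R\<^sup>*"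
        proof
          have "rk z \<le> rk y" if "(y, z) \<in> R\<^sup>*" for y z
            using that by (induction rule: rtrancl_induct) (use rk in \<open>fastforce simp: R_def\<close>)+
          moreover assume "(par b, b) \<in> R\<^sup>*"
          ultimately have "rk b \<le> rk (par b)" by blast
          then show False using rk[OF b] by simp
        qed
        then show ?thesis using par[OF b] by (simp add: A_def B_def)
      qed
      have M0: "M \<ge> 0" by (simp add: M nonneg)
      have edgeA: "?E v \<le> M" if "v \<in> A - {r}" for v using edge that by (auto simp: A_def)
      have rkA: "rk (par v) < rk v" if "v \<in> A - {r}" for v using rk that by (auto simp: A_def)
      have root: "D r x \<le> M * real (card A - 1)" if "x \<in> A" for x
        by (rule tree_dist_root_le[where D = D and V = A and r = r and M = M and par = par and rk = rk, OF refl tri fin(1) M0 parA rkA edgeA that])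
      \<comment> \<open>Detour from the end \<open>l\<close> of the first path up to the root, down
        to \<open>par b\<close>, and across the deleted edge: at most
        \<open>2 * (card A - 1) + 1\<close> edges.\<close>
      have "D l b \<le> D l r + (D r (par b) + D (par b) b)" by (meson add_left_mono order_trans tri)
      also have "\<dots> \<le> M * real (card A - 1) + (M * real (card A - 1) + M)"
        using root[OF l] root[OF parb] comm[of l r] by (simp add: M)
      also have "\<dots> \<le> 2 * real (card V - 1) * M"
      proof -
        have "(2 * real (card A - 1) + 1) * M \<le> (2 * real (card V - 1)) * M"
          using M0 cA cB card by (intro mult_right_mono) (auto simp: of_nat_diff)
        then show ?thesis by (simp add: algebra_simps)
      qed
      finally have step: "D l b \<le> 2 * real (card V - 1) * M" .
      let ?a = "card A - 1" and ?b = "card B - 1"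
      have cV: "card V - 1 = Suc (?a + ?b)" using card cA cB by simp
      have pos: "(\<Prod>v\<in>S. ?E v) \<ge> 0" for S by (intro prod_nonneg) (simp add: nonneg)
      have "chain_prod D ((r # as) @ (b # bs)) = chain_prod D (r # as) * D l b * chain_prod D (b # bs)"
        by (subst chain_prod_append) (auto simp: l_def)
      also have "\<dots> \<le> (2 ^ ?a * fact ?a * (\<Prod>v\<in>A - {r}. ?E v)) * (2 * real (card V - 1) * M) *
          (2 ^ ?b * fact ?b * (\<Prod>v\<in>B - {b}. ?E v))"
        using as(3) bs(3) step pos M0
        by (intro mult_mono) (auto intro!: mult_nonneg_nonneg chain_prod_nonneg nonneg)
      also have "\<dots> = 2 ^ (card V - 1) * (real (card V - 1) * (fact ?a * fact ?b)) *
          ((\<Prod>v\<in>A - {r}. ?E v) * (?E b * (\<Prod>v\<in>B - {b}. ?E v)))"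
      proof -
        have "(2 :: real) ^ (card V - 1) = 2 * (2 ^ ?a * 2 ^ ?b)" by (simp only: cV power_Suc power_add)
        then show ?thesis by (simp only: M mult_ac)
      qed
      also have "?E b * (\<Prod>v\<in>B - {b}. ?E v) = (\<Prod>v\<in>B. ?E v)"
        using fin bB by (subst prod.remove[of B b]) auto
      also have "(\<Prod>v\<in>A - {r}. ?E v) * (\<Prod>v\<in>B. ?E v) = (\<Prod>v\<in>V - {r}. ?E v)"
      proof -
        have "V - {r} = (A - {r}) \<union> B" using AB rB by auto
        then show ?thesis using fin AB by (subst prod.union_disjoint[symmetric]) auto
      qed
      also have "2 ^ (card V - 1) * (real (card V - 1) * (fact ?a * fact ?b)) * (\<Prod>v\<in>V - {r}. ?E v) \<le>
          2 ^ (card V - 1) * fact (card V - 1) * (\<Prod>v\<in>V - {r}. ?E v)"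
      proof -
        \<comment> \<open>With the factor \<open>card V - 1 = ?a + ?b + 1\<close> from the joining
          step, this rebuilds the factorial of the whole tree.\<close>
        have "(fact ?a * fact ?b :: nat) \<le> fact (?a + ?b)"
          by (rule dvd_imp_le[OF fact_fact_dvd_fact]) simp
        then have "(fact ?a * fact ?b :: real) \<le> fact (?a + ?b)"
          by (metis of_nat_fact of_nat_le_iff of_nat_mult)
        then have "real (card V - 1) * (fact ?a * fact ?b) \<le> real (card V - 1) * fact (?a + ?b)"
          by (rule mult_left_mono) simp
        also have "\<dots> = fact (card V - 1)" by (simp only: cV fact_Suc)
        finally show ?thesis using pos by (intro mult_right_mono mult_left_mono) auto
      qed
      finally have "chain_prod D (r # (as @ b # bs)) \<le> 2 ^ (card V - 1) * fact (card V - 1) * (\<Prod>v\<in>V - {r}. ?E v)"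
        by simp
      moreover have "distinct (r # (as @ b # bs))" "set (r # (as @ b # bs)) = V"
        using as(1,2) bs(1,2) AB by auto
      ultimately show ?thesis by blast
    qed
  qed
  then show ?thesis using that by blast
qed

subsection \<open>The chain of visits\<close>

lemma sets_walk_Collect: "Measurable.pred (walk x) P \<Longrightarrow> {\<omega>. P \<omega>} \<in> sets (walk x)"
  by (simp add: pred_def)

lemma local_time_split:
  "local_time \<omega> z = (\<Sum>k<n. if \<omega> k = z then 1 else 0) + local_time (shift n \<omega>) z"
proof (induction n)
  case (Suc n)
  have "(\<lambda>k. if shift n \<omega> k = z then 1 else 0 :: ennreal) sums
      (local_time (shift (Suc n) \<omega>) z + (if shift n \<omega> 0 = z then 1 else 0))"
    by (rule sums_Suc) (simp add: local_time_def summable_sums)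
  then have "local_time (shift n \<omega>) z = local_time (shift (Suc n) \<omega>) z + (if \<omega> n = z then 1 else 0)"
    by (simp add: local_time_def sums_iff)
  then show ?case using Suc by (simp add: ac_simps)
qed simp

text \<open>Time zero is left out: when the walk stands at a site of \<open>\<Lambda>\<close>, that
  visit is already recorded and \<open>m\<close> prescribes only those still to come.\<close>

definition visits :: "'a set \<Rightarrow> ('a \<Rightarrow> nat) \<Rightarrow> (nat \<Rightarrow> 'a) set" where
  "visits \<Lambda> m = {\<omega>. \<forall>z\<in>\<Lambda>. local_time (shift 1 \<omega>) z = of_nat (m z)}"

definition first_return :: "'a set \<Rightarrow> 'a \<Rightarrow> nat \<Rightarrow> (nat \<Rightarrow> 'a) set" where
  "first_return \<Lambda> y t = {\<omega>. 0 < t \<and> \<omega> t = y \<and> (\<forall>k. 0 < k \<longrightarrow> k < t \<longrightarrow> \<omega> k \<notin> \<Lambda>)}"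

text \<open>For \<open>y \<in> \<Lambda>\<close>, the transition kernel of the walk watched only on
  \<open>\<Lambda>\<close>.\<close>

definition return_prob :: "(int ^ 'd) set \<Rightarrow> int ^ 'd \<Rightarrow> int ^ 'd \<Rightarrow> real" where
  "return_prob \<Lambda> x y = measure (walk x) (\<Union>t. first_return \<Lambda> y t)"

definition escape :: "(int ^ 'd) set \<Rightarrow> int ^ 'd \<Rightarrow> real" where
  "escape \<Lambda> x = \<P>(\<omega> in walk x. return_time \<Lambda> \<omega> = \<infinity>)"

lemma escape_nonneg: "escape \<Lambda> x \<ge> 0" by (simp add: escape_def)

lemma escape_le_1: "escape \<Lambda> x \<le> 1"
  by (simp add: escape_def prob_space.prob_le_1[OF prob_space_walk])

lemma return_prob_nonneg: "return_prob \<Lambda> x y \<ge> 0" by (simp add: return_prob_def)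

lemma sets_visits:
  fixes \<Lambda> :: "(int ^ 'd) set"
  assumes "finite \<Lambda>"
  shows "visits \<Lambda> m \<in> sets paths"
proof -
  have [measurable]: "(\<lambda>\<omega>. local_time (shift 1 \<omega>) z) \<in> borel_measurable (walk x)" for x z :: "int ^ 'd"
    unfolding local_time_def by measurable
  show ?thesis unfolding visits_def
    by (rule paths_event) (use assms in measurable)
qed

lemma sets_first_return: "first_return \<Lambda> y t \<in> sets (paths :: (nat \<Rightarrow> int ^ 'd) measure)"
  unfolding first_return_def by (rule paths_event) measurable

lemma first_return_unique:
  "\<omega> \<in> first_return \<Lambda> y t \<Longrightarrow> \<omega> \<in> first_return \<Lambda> y' t' \<Longrightarrow> y \<in> \<Lambda> \<Longrightarrow> y' \<in> \<Lambda> \<Longrightarrow> t = t' \<and> y = y'"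
  unfolding first_return_def by (cases t t' rule: linorder_cases) auto

text \<open>First returns at different sites exclude each other, and all of them exclude
  escape.\<close>

lemma sum_return_prob_le:
  assumes "finite \<Lambda>"
  shows "(\<Sum>y\<in>\<Lambda>. return_prob \<Lambda> x y) \<le> 1 - escape \<Lambda> x"
proof -
  interpret prob_space "walk x" by (rule prob_space_walk)
  let ?U = "\<lambda>y. \<Union>t. first_return \<Lambda> y t"
  let ?I = "{\<omega>. return_time \<Lambda> \<omega> = \<infinity>}"
  have U: "?U y \<in> events" for y
    using sets_first_return by (auto simp: sets_walk)
  have I: "?I \<in> events" by (rule sets_walk_Collect) measurable
  have "(\<Sum>y\<in>\<Lambda>. return_prob \<Lambda> x y) = prob (\<Union>y\<in>\<Lambda>. ?U y)"
    unfolding return_prob_def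
  proof (rule finite_measure_finite_Union[symmetric])
    show "disjoint_family_on ?U \<Lambda>"
      by (auto simp: disjoint_family_on_def dest: first_return_unique)
  qed (use assms U in auto)
  moreover have "prob (\<Union>y\<in>\<Lambda>. ?U y) + prob ?I = prob ((\<Union>y\<in>\<Lambda>. ?U y) \<union> ?I)"
  proof (rule finite_measure_Union[symmetric])
    show "(\<Union>y\<in>\<Lambda>. ?U y) \<inter> ?I = {}"
    proof -
      have "return_time \<Lambda> \<omega> < \<infinity>" if "y \<in> \<Lambda>" "\<omega> \<in> first_return \<Lambda> y t" for \<omega> y t
        using that unfolding return_time_def INF_less_iff first_return_def by (intro bexI[of _ t]) auto
      then show ?thesis by force
    qed
  qed (use assms U I in \<open>auto intro!: sets.finite_UN\<close>)
  moreover have "prob ((\<Union>y\<in>\<Lambda>. ?U y) \<union> ?I) \<le> 1" by (rule prob_le_1)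
  moreover have "prob ?I = escape \<Lambda> x" by (simp add: escape_def)
  ultimately show ?thesis by linarith
qed

lemma return_prob_le_hit: "return_prob \<Lambda> x y \<le> hit x y"
proof -
  interpret prob_space "walk x" by (rule prob_space_walk)
  have "(\<Union>t. first_return \<Lambda> y t) \<subseteq> {\<omega>. hitting_time y \<omega> < \<infinity>}"
    unfolding hitting_time_finite first_return_def by auto
  moreover have "{\<omega>. hitting_time y \<omega> < \<infinity>} \<in> events" by (rule sets_walk_Collect) measurable
  ultimately show ?thesis unfolding return_prob_def hit_def
    by (auto intro: finite_measure_mono)
qed

text \<open>A visit to \<open>z0\<close> is still due, so a first return to \<open>\<Lambda>\<close>
  occurs. The site found there spends one of its visits, and the strong Markov property restarts the
  walk.\<close>

lemma visits_recursion:
  fixes \<Lambda> :: "(int ^ 'd) set"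
  assumes fin: "finite \<Lambda>" and pos: "z0 \<in> \<Lambda>" "m z0 > 0"
  shows "measure (walk x) (visits \<Lambda> m) \<le>
    (\<Sum>y | y \<in> \<Lambda> \<and> m y > 0. return_prob \<Lambda> x y * measure (walk y) (visits \<Lambda> (m(y := m y - 1))))"
proof -
  interpret prob_space "walk x" by (rule prob_space_walk)
  let ?Y = "{y \<in> \<Lambda>. m y > 0}"
  let ?B = "\<lambda>y. visits \<Lambda> (m(y := m y - 1))"
  let ?E = "\<lambda>y t. {\<omega> \<in> first_return \<Lambda> y t. shift t \<omega> \<in> ?B y}"
  have E: "?E y t \<in> events" for y t
  proof -
    have "first_return \<Lambda> y t \<inter> (shift t -` ?B y \<inter> space paths) \<in> sets paths"
      by (intro sets.Int sets_first_return measurable_sets[OF measurable_shift_paths sets_visits[OF fin]])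
    moreover have "first_return \<Lambda> y t \<inter> (shift t -` ?B y \<inter> space paths) = ?E y t"
      by (auto simp: space_PiM)
    ultimately show ?thesis by (simp add: sets_walk)
  qed
  have sub: "visits \<Lambda> m \<subseteq> (\<Union>y\<in>?Y. \<Union>t. ?E y t)"
  proof
    fix \<omega> assume \<omega>: "\<omega> \<in> visits \<Lambda> m"
    have "\<exists>k>0. \<omega> k \<in> \<Lambda>"
    proof (rule ccontr)
      assume "\<not> ?thesis"
      then have "\<omega> (Suc k) \<noteq> z0" for k using pos by auto
      then have "local_time (shift 1 \<omega>) z0 = 0" by (simp add: local_time_def)
      then show False using \<omega> pos by (auto simp: visits_def)
    qed
    then obtain t where t: "t > 0" "\<omega> t \<in> \<Lambda>" and min: "\<And>k. k > 0 \<Longrightarrow> k < t \<Longrightarrow> \<omega> k \<notin> \<Lambda>"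
      using exists_least_iff[of "\<lambda>k. k > 0 \<and> \<omega> k \<in> \<Lambda>"] by blast
    define y where "y = \<omega> t"
    have ret: "\<omega> \<in> first_return \<Lambda> y t" using t min by (auto simp: first_return_def y_def)
    \<comment> \<open>\<open>shift 1\<close> moves the clock by one, so the first \<open>t\<close>
      terms cover the times 1 to \<open>t\<close>, of which only \<open>t\<close> is a visit to
      \<open>\<Lambda>\<close>.\<close>
    have split: "of_nat (m z) = (if z = y then 1 else 0) + local_time (shift 1 (shift t \<omega>)) z" if "z \<in> \<Lambda>" for z
    proof -
      obtain s where s: "t = Suc s" using t(1) by (cases t) auto
      have "(\<Sum>k<t. if shift 1 \<omega> k = z then 1 else 0 :: ennreal) = (if z = y then 1 else 0)"
      proof -
        have "(\<Sum>k<s. if shift 1 \<omega> k = z then 1 else 0 :: ennreal) = 0"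
          using min that s by (intro sum.neutral) auto
        then show ?thesis by (auto simp: s y_def)
      qed
      moreover have "shift t (shift 1 \<omega>) = shift 1 (shift t \<omega>)" by (simp add: algebra_simps)
      moreover have "local_time (shift 1 \<omega>) z = of_nat (m z)" using \<omega> that by (simp add: visits_def)
      ultimately show ?thesis using local_time_split[of "shift 1 \<omega>" z t] by simp
    qed
    have y: "y \<in> \<Lambda>" using t by (simp add: y_def)
    have my: "m y > 0" using split[OF y] by (cases "m y") auto
    have "local_time (shift 1 (shift t \<omega>)) z = of_nat ((m(y := m y - 1)) z)" if "z \<in> \<Lambda>" for z
    proof (cases "z = y")
      case True
      have "(1 :: ennreal) + of_nat (m y - 1) = of_nat (m y)"
        using my by (metis Suc_diff_1 of_nat_Suc)
      then have "1 + local_time (shift 1 (shift t \<omega>)) y = 1 + of_nat (m y - 1)" using split[OF y] by simp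
      then show ?thesis using True by (simp add: ennreal_add_left_cancel)
    next
      case False
      then show ?thesis using split[OF that] by simp
    qed
    then have "shift t \<omega> \<in> ?B y" by (simp add: visits_def)
    then show "\<omega> \<in> (\<Union>y\<in>?Y. \<Union>t. ?E y t)" using ret y my by blast
  qed
  have "prob (visits \<Lambda> m) \<le> prob (\<Union>y\<in>?Y. \<Union>t. ?E y t)"
    using sub E fin by (intro finite_measure_mono) (auto intro!: sets.finite_UN)
  also have "\<dots> \<le> (\<Sum>y\<in>?Y. prob (\<Union>t. ?E y t))"
    using fin E by (intro finite_measure_subadditive_finite) auto
  also have "\<dots> = (\<Sum>y\<in>?Y. return_prob \<Lambda> x y * measure (walk y) (?B y))"
  proof (rule sum.cong[OF refl])
    fix y assume "y \<in> ?Y"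
    then have y: "y \<in> \<Lambda>" by simp
    show "prob (\<Union>t. ?E y t) = return_prob \<Lambda> x y * measure (walk y) (?B y)"
      unfolding return_prob_def
    proof (rule walk_strong_markov)
      show "disjoint_family (first_return \<Lambda> y)"
        unfolding disjoint_family_on_def using first_return_unique[of _ \<Lambda> y _ y] y by blast
      show "\<omega>' \<in> first_return \<Lambda> y t"
        if "\<And>k. k \<le> t \<Longrightarrow> \<omega> k = \<omega>' k" "\<omega> \<in> first_return \<Lambda> y t" for t \<omega> \<omega>'
        using that by (auto simp: first_return_def)
    qed (auto simp: first_return_def sets_visits[OF fin] intro: sets_first_return[unfolded first_return_def])
  qed
  finally show ?thesis by simp
qed

section \<open>Weights of the orders of discovery\<close>

text \<open>
  The list is the order in which new sites are discovered. A new site \<open>y\<close> is discovered from some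
  visited site \<open>p\<close>, and \<open>r p\<close> counts the exits from \<open>p\<close> at which this can happen.
\<close>

fun growth_weight :: "('a \<Rightarrow> nat) \<Rightarrow> ('a \<Rightarrow> 'a \<Rightarrow> real) \<Rightarrow> 'a set \<Rightarrow> 'a list \<Rightarrow> real" where
  "growth_weight r c A [] = 1"
| "growth_weight r c A (y # ys) = (\<Sum>p\<in>A. r p * c p y) * growth_weight r c (insert y A) ys"

lemma growth_weight_nonneg: "(\<And>p y. c p y \<ge> 0) \<Longrightarrow> growth_weight r c A ys \<ge> 0"
  by (induction ys arbitrary: A) (auto intro!: mult_nonneg_nonneg sum_nonneg)

definition growth_sum :: "('a \<Rightarrow> nat) \<Rightarrow> ('a \<Rightarrow> 'a \<Rightarrow> real) \<Rightarrow> 'a set \<Rightarrow> 'a set \<Rightarrow> real" where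
  "growth_sum r c \<Lambda> A = (\<Sum>\<gamma>\<in>permutations_of_set (\<Lambda> - A). growth_weight r c A \<gamma>)"

lemma growth_sum_nonneg: "(\<And>p y. c p y \<ge> 0) \<Longrightarrow> growth_sum r c \<Lambda> A \<ge> 0"
  by (simp add: growth_sum_def growth_weight_nonneg sum_nonneg)

lemma growth_weight_mono:
  assumes "\<And>p y. c p y \<ge> 0" "\<And>p. r p \<le> r' p"
  shows "growth_weight r c A ys \<le> growth_weight r' c A ys"
proof (induction ys arbitrary: A)
  case (Cons y ys)
  show ?case
    unfolding growth_weight.simps using assms Cons
    by (intro mult_mono sum_mono) (auto intro!: mult_right_mono sum_nonneg growth_weight_nonneg)
qed simp

lemma growth_sum_mono:
  "(\<And>p y. c p y \<ge> 0) \<Longrightarrow> (\<And>p. r p \<le> r' p) \<Longrightarrow> growth_sum r c \<Lambda> A \<le> growth_sum r' c \<Lambda> A"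
  unfolding growth_sum_def by (intro sum_mono growth_weight_mono)

lemma growth_sum_subset: "\<Lambda> \<subseteq> A \<Longrightarrow> growth_sum r c \<Lambda> A = 1"
  by (simp add: growth_sum_def Diff_eq_empty_iff[THEN iffD2])

text \<open>The orderings are sorted by their first element, the next site to be discovered.\<close>

lemma growth_sum_rec:
  assumes "finite \<Lambda>" "\<Lambda> - A \<noteq> {}"
  shows "growth_sum r c \<Lambda> A = (\<Sum>y\<in>\<Lambda> - A. (\<Sum>p\<in>A. r p * c p y) * growth_sum r c \<Lambda> (insert y A))"
proof -
  have "growth_sum r c \<Lambda> A =
      (\<Sum>y\<in>\<Lambda> - A. \<Sum>\<gamma>\<in>(#) y ` permutations_of_set (\<Lambda> - A - {y}). growth_weight r c A \<gamma>)"
    unfolding growth_sum_def permutations_of_set_nonempty[OF assms(2)]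
    using assms(1) by (intro sum.UNION_disjoint) auto
  also have "\<dots> = (\<Sum>y\<in>\<Lambda> - A. \<Sum>\<gamma>\<in>permutations_of_set (\<Lambda> - insert y A). growth_weight r c A (y # \<gamma>))"
  proof (rule sum.cong[OF refl])
    fix y assume "y \<in> \<Lambda> - A"
    have "\<Lambda> - A - {y} = \<Lambda> - insert y A" by auto
    then show "(\<Sum>\<gamma>\<in>(#) y ` permutations_of_set (\<Lambda> - A - {y}). growth_weight r c A \<gamma>) =
        (\<Sum>\<gamma>\<in>permutations_of_set (\<Lambda> - insert y A). growth_weight r c A (y # \<gamma>))"
      by (simp add: sum.reindex)
  qed
  finally show ?thesis by (simp add: growth_sum_def sum_distrib_left)
qed

text \<open>One more exit from \<open>x\<close> may or may not discover a new site.\<close>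

lemma growth_sum_step:
  assumes c: "\<And>p y. c p y \<ge> 0" and fin: "finite \<Lambda>" "finite A" and x: "x \<in> A"
  shows "growth_sum m c \<Lambda> A + (\<Sum>y\<in>\<Lambda> - A. c x y * growth_sum m c \<Lambda> (insert y A))
    \<le> growth_sum (m(x := m x + 1)) c \<Lambda> A"
proof (cases "\<Lambda> - A = {}")
  case True
  then have "\<Lambda> \<subseteq> A" by auto
  then show ?thesis unfolding True by (simp add: growth_sum_subset)
next
  case False
  let ?r = "m(x := m x + 1)"
  have "(\<Sum>p\<in>A. ?r p * c p y) = (\<Sum>p\<in>A. m p * c p y) + c x y" for y
  proof -
    have "(\<Sum>p\<in>A. ?r p * c p y) = (\<Sum>p\<in>A. m p * c p y + (if p = x then c x y else 0))"
      by (intro sum.cong) (auto simp: algebra_simps)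
    then show ?thesis using fin x by (simp add: sum.distrib)
  qed
  moreover have "growth_sum m c \<Lambda> A + (\<Sum>y\<in>\<Lambda> - A. c x y * growth_sum m c \<Lambda> (insert y A)) =
      (\<Sum>y\<in>\<Lambda> - A. ((\<Sum>p\<in>A. m p * c p y) + c x y) * growth_sum m c \<Lambda> (insert y A))"
    by (simp add: growth_sum_rec[OF fin(1) False] sum.distrib[symmetric] distrib_right)
  \<comment> \<open>Later discoveries may also use the additional exit from \<open>x\<close>; this
    only enlarges the sum.\<close>
  moreover have "(\<Sum>y\<in>\<Lambda> - A. ((\<Sum>p\<in>A. m p * c p y) + c x y) * growth_sum m c \<Lambda> (insert y A)) \<le>
      (\<Sum>y\<in>\<Lambda> - A. ((\<Sum>p\<in>A. m p * c p y) + c x y) * growth_sum ?r c \<Lambda> (insert y A))"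
    using c by (intro sum_mono mult_left_mono growth_sum_mono)
      (auto intro!: add_nonneg_nonneg sum_nonneg)
  ultimately show ?thesis by (simp only: growth_sum_rec[OF fin(1) False])
qed

text \<open>
  Every exit from a site \<open>z\<close> returns to \<open>\<Lambda>\<close> with probability at most \<open>b z\<close>. The exits that discover
  a new site are accounted for by \<open>growth_sum\<close>, and the final escape costs at most \<open>exp 1\<close>.
\<close>

lemma visits_bound:
  fixes \<Lambda> V :: "(int ^ 'd) set" and b c
  assumes fin: "finite \<Lambda>" "finite V" and "\<Lambda> \<subseteq> V"
  defines "b \<equiv> \<lambda>z. exp (- escape \<Lambda> z)"
  defines "c \<equiv> \<lambda>x y. return_prob \<Lambda> x y / b x"
  assumes "x \<in> A" "A \<subseteq> V" "\<And>z. z \<in> \<Lambda> - A \<Longrightarrow> m z > 0" "\<And>z. z \<in> V - \<Lambda> \<Longrightarrow> m z = 0"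
  shows "measure (walk x) (visits \<Lambda> m) \<le>
    exp 1 * (\<Prod>z\<in>V. b z ^ (m(x := m x + 1)) z) * growth_sum (m(x := m x + 1)) c \<Lambda> A"
  using assms(6-)
proof (induction "\<Sum>z\<in>\<Lambda>. m z" arbitrary: m x A rule: less_induct)
  case less
  \<comment> \<open>Exits, not arrivals: the visits still to come, plus the present stay at
    \<open>x\<close>.\<close>
  let ?r = "m(x := m x + 1)"
  have xV: "x \<in> V" using less by auto
  have b_pos: "b z > 0" for z by (simp add: b_def)
  have c0: "c p y \<ge> 0" for p y using b_pos[of p] by (simp add: c_def return_prob_nonneg)
  have finA: "finite A" using less fin finite_subset by blast
  have W: "(\<Prod>z\<in>V. b z ^ ?r z) = b x * (\<Prod>z\<in>V. b z ^ m z)"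
  proof -
    have "(\<Prod>z\<in>V. b z ^ ?r z) = (\<Prod>z\<in>V. b z ^ m z * (if z = x then b x else 1))"
      by (intro prod.cong) auto
    then show ?thesis using fin xV by (simp add: prod.distrib)
  qed
  let ?W = "\<Prod>z\<in>V. b z ^ m z"
  have W0: "?W \<ge> 0" using b_pos by (intro prod_nonneg) (auto intro: less_imp_le)
  show ?case
  proof (cases "\<exists>z\<in>\<Lambda>. m z > 0")
    case False
    then have sub: "\<Lambda> \<subseteq> A" using less.prems(3) by fastforce
    have "?W = 1"
    proof (rule prod.neutral, rule ballI)
      fix z assume "z \<in> V"
      then have "m z = 0" using False less.prems(4) by (cases "z \<in> \<Lambda>") auto
      then show "b z ^ m z = 1" by simp
    qed
    \<comment> \<open>No visit remains, and the trivial bound 1 is paid for by \<open>exp 1\<close>,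
      since the escape probability is at most 1.\<close>
    moreover have "1 \<le> exp 1 * b x" using escape_le_1[of \<Lambda> x] by (simp add: b_def exp_add[symmetric])
    ultimately show ?thesis
      using prob_space.prob_le_1[OF prob_space_walk, of x "visits \<Lambda> m"]
      unfolding W growth_sum_subset[OF sub] by simp
  next
    case True
    then obtain z0 where z0: "z0 \<in> \<Lambda>" "m z0 > 0" by blast
    let ?Y = "{y. y \<in> \<Lambda> \<and> m y > 0}"
    let ?G = "\<lambda>y. growth_sum m c \<Lambda> (insert y A)"
    have IH: "measure (walk y) (visits \<Lambda> (m(y := m y - 1))) \<le> exp 1 * ?W * ?G y" if y: "y \<in> ?Y" for y
    proof -
      let ?m = "m(y := m y - 1)"
      \<comment> \<open>The arrival at \<open>y\<close> just spent returns as the coming exit from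
        \<open>y\<close>, so the hypothesis speaks of the exit counts \<open>m\<close>.\<close>
      have eq: "?m(y := ?m y + 1) = m" using y by auto
      have lt: "(\<Sum>z\<in>\<Lambda>. ?m z) < (\<Sum>z\<in>\<Lambda>. m z)"
        using y fin by (intro sum_strict_mono_ex1) auto
      have sub: "insert y A \<subseteq> V" using y less.prems \<open>\<Lambda> \<subseteq> V\<close> by auto
      have m_pos: "?m z > 0" if "z \<in> \<Lambda> - insert y A" for z using that less.prems(3) by auto
      have m_0: "?m z = 0" if "z \<in> V - \<Lambda>" for z using that y less.prems(4)[of z] by auto
      from less.hyps[of ?m y "insert y A", OF lt insertI1 sub m_pos m_0] show ?thesis unfolding eq .
    qed
    have "measure (walk x) (visits \<Lambda> m) \<le>
        (\<Sum>y\<in>?Y. return_prob \<Lambda> x y * measure (walk y) (visits \<Lambda> (m(y := m y - 1))))"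
      by (rule visits_recursion[where x = x and m = m, OF fin(1) z0])
    also have "\<dots> \<le> (\<Sum>y\<in>?Y. return_prob \<Lambda> x y * (exp 1 * ?W * ?G y))"
      by (intro sum_mono mult_left_mono IH return_prob_nonneg)
    also have "\<dots> \<le> (\<Sum>y\<in>\<Lambda>. return_prob \<Lambda> x y * (exp 1 * ?W * ?G y))"
      using fin W0 c0 by (intro sum_mono2) (auto intro!: mult_nonneg_nonneg return_prob_nonneg growth_sum_nonneg)
    also have "\<dots> = exp 1 * ?W * (\<Sum>y\<in>\<Lambda>. return_prob \<Lambda> x y * ?G y)"
      by (simp add: sum_distrib_left algebra_simps)
    also have "\<dots> \<le> exp 1 * ?W * (b x * growth_sum ?r c \<Lambda> A)"
    proof (rule mult_left_mono)
      \<comment> \<open>Returns to discovered sites leave \<open>A\<close> unchanged and together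
        cost at most \<open>b x\<close>. A return to a new site keeps its own probability, written
        as \<open>b x * c x y\<close>.\<close>
      have "(\<Sum>y\<in>\<Lambda>. return_prob \<Lambda> x y * ?G y) =
          (\<Sum>y\<in>\<Lambda> \<inter> A. return_prob \<Lambda> x y * ?G y) + (\<Sum>y\<in>\<Lambda> - A. return_prob \<Lambda> x y * ?G y)"
        using fin by (subst sum.union_disjoint[symmetric]) (auto simp: Int_Diff_Un)
      also have "(\<Sum>y\<in>\<Lambda> \<inter> A. return_prob \<Lambda> x y * ?G y) = (\<Sum>y\<in>\<Lambda> \<inter> A. return_prob \<Lambda> x y) * growth_sum m c \<Lambda> A"
        by (auto simp: sum_distrib_right insert_absorb intro!: sum.cong)
      also have "(\<Sum>y\<in>\<Lambda> \<inter> A. return_prob \<Lambda> x y) \<le> b x"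
      proof -
        have "(\<Sum>y\<in>\<Lambda> \<inter> A. return_prob \<Lambda> x y) \<le> (\<Sum>y\<in>\<Lambda>. return_prob \<Lambda> x y)"
          using fin by (intro sum_mono2) (auto simp: return_prob_nonneg)
        also have "\<dots> \<le> 1 - escape \<Lambda> x" by (rule sum_return_prob_le[OF fin(1)])
        also have "\<dots> \<le> b x" using exp_ge_add_one_self[of "- escape \<Lambda> x"] by (simp add: b_def)
        finally show ?thesis .
      qed
      also have "(\<Sum>y\<in>\<Lambda> - A. return_prob \<Lambda> x y * ?G y) = b x * (\<Sum>y\<in>\<Lambda> - A. c x y * ?G y)"
        using b_pos[of x] by (simp add: c_def sum_distrib_left)
      finally have "(\<Sum>y\<in>\<Lambda>. return_prob \<Lambda> x y * ?G y) \<le>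
          b x * growth_sum m c \<Lambda> A + b x * (\<Sum>y\<in>\<Lambda> - A. c x y * ?G y)"
        using growth_sum_nonneg[of c m \<Lambda> A] c0 by (simp add: mult_right_mono)
      also have "\<dots> = b x * (growth_sum m c \<Lambda> A + (\<Sum>y\<in>\<Lambda> - A. c x y * ?G y))"
        by (simp add: distrib_left)
      also have "\<dots> \<le> b x * growth_sum ?r c \<Lambda> A"
        using growth_sum_step[OF c0 fin(1) finA less.prems(1)] b_pos[of x] by (intro mult_left_mono) auto
      finally show "(\<Sum>y\<in>\<Lambda>. return_prob \<Lambda> x y * ?G y) \<le> b x * growth_sum ?r c \<Lambda> A" .
    qed (use W0 in auto)
    also have "\<dots> = exp 1 * (\<Prod>z\<in>V. b z ^ ?r z) * growth_sum ?r c \<Lambda> A"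
      by (simp only: W mult_ac)
    finally show ?thesis .
  qed
qed

subsection \<open>Summation over trees\<close>

lemma path_weight_eq: "path_weight \<gamma> = chain_prod hit (0 # \<gamma>)"
proof -
  have "(\<Prod>k<length ys. hit ((x # ys) ! k) (ys ! k)) = chain_prod hit (x # ys)" for x and ys :: "(int ^ 'a) list"
    by (induction ys arbitrary: x) (simp_all add: prod.lessThan_Suc_shift del: prod.lessThan_Suc)
  from this[where x = 0 and ys = \<gamma>] show ?thesis
    by (simp only: path_weight_def hit_def[symmetric] One_nat_def prod.atLeast1_atMost_eq
        diff_Suc_Suc diff_zero nth_Cons_Suc)
qed

text \<open>The lower bounds are multiplied along the path; distinctness keeps consecutive points
  apart. Clearing denominators lets the induction multiply inequalities.\<close>

lemma chain_prod_le_power: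
  fixes h D :: "'a \<Rightarrow> 'a \<Rightarrow> real"
  assumes "c > 0" and D: "\<And>x y. x \<noteq> y \<Longrightarrow> D x y > 0"
    and h: "\<And>x y. x \<noteq> y \<Longrightarrow> c / D x y ^ k \<le> h x y"
  shows "distinct (x # xs) \<Longrightarrow> chain_prod D (x # xs) > 0 \<and>
    c ^ length xs \<le> chain_prod h (x # xs) * chain_prod D (x # xs) ^ k"
proof (induction xs arbitrary: x)
  case (Cons y ys)
  then have xy: "x \<noteq> y" and IH: "chain_prod D (y # ys) > 0"
    "c ^ length ys \<le> chain_prod h (y # ys) * chain_prod D (y # ys) ^ k" by auto
  have "c \<le> h x y * D x y ^ k"
    using h[OF xy] D[OF xy] by (simp add: divide_le_eq)
  then have "c * c ^ length ys \<le> (h x y * D x y ^ k) * (chain_prod h (y # ys) * chain_prod D (y # ys) ^ k)"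
    using IH \<open>c > 0\<close> by (intro mult_mono) (auto intro: order_trans[of 0 c] less_imp_le)
  then show ?case using D[OF xy] IH by (simp add: power_mult_distrib mult_ac)
qed auto

text \<open>Each new site takes as parent the present site with the largest \<open>h\<close>. The
  sum over parents is at most the number of present sites times that maximum, and these growing
  numbers multiply to a quotient of factorials.\<close>

lemma growth_weight_le_tree:
  fixes h :: "'a \<Rightarrow> 'a \<Rightarrow> real" and N :: real
  assumes h: "\<And>p y. h p y \<ge> 0" and c: "\<And>p y. c p y \<ge> 0" and N: "N \<ge> 0"
    and rc: "\<And>p y. p \<in> A \<union> set ys \<Longrightarrow> real (r p) * c p y \<le> N * h p y"
    and A: "finite A" "A \<noteq> {}" and ys: "distinct ys" "set ys \<inter> A = {}"
  obtains par and rk :: "'a \<Rightarrow> nat" where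
    "\<And>v. v \<in> set ys \<Longrightarrow> par v \<in> A \<union> set ys" "\<And>v. v \<in> set ys \<Longrightarrow> rk (par v) < rk v"
    "growth_weight r c A ys * fact (card A - 1) \<le>
      fact (card A - 1 + length ys) * (N ^ length ys * (\<Prod>v\<in>set ys. h (par v) v))"
proof -
  have "\<exists>par (rk :: 'a \<Rightarrow> nat). (\<forall>v\<in>set ys. par v \<in> A \<union> set ys \<and> rk (par v) < rk v \<and> 0 < rk v) \<and> (\<forall>v\<in>A. rk v = 0) \<and>
      growth_weight r c A ys * fact (card A - 1) \<le>
      fact (card A - 1 + length ys) * (N ^ length ys * (\<Prod>v\<in>set ys. h (par v) v))"
    using rc A ys
  proof (induction ys arbitrary: A)
    case Nil
    then show ?case by (auto intro!: exI[of _ "\<lambda>_. 0"])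
  next
    case (Cons y ys)
    have yA: "y \<notin> A" and yys: "y \<notin> set ys" using Cons.prems by auto
    have "\<exists>par (rk :: 'a \<Rightarrow> nat). (\<forall>v\<in>set ys. par v \<in> insert y A \<union> set ys \<and> rk (par v) < rk v \<and> 0 < rk v) \<and>
        (\<forall>v\<in>insert y A. rk v = 0) \<and>
        growth_weight r c (insert y A) ys * fact (card (insert y A) - 1) \<le>
        fact (card (insert y A) - 1 + length ys) * (N ^ length ys * (\<Prod>v\<in>set ys. h (par v) v))"
      using Cons.prems by (intro Cons.IH) auto
    then obtain par and rk :: "'a \<Rightarrow> nat" where
      par: "\<And>v. v \<in> set ys \<Longrightarrow> par v \<in> insert y A \<union> set ys" and
      rk: "\<And>v. v \<in> set ys \<Longrightarrow> rk (par v) < rk v" and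
      le: "growth_weight r c (insert y A) ys * fact (card A) \<le>
        fact (card A + length ys) * (N ^ length ys * (\<Prod>v\<in>set ys. h (par v) v))"
      using yA Cons.prems(2) by auto
    define M where "M = Max ((\<lambda>p. h p y) ` A)"
    have "M \<in> (\<lambda>p. h p y) ` A" unfolding M_def using Cons.prems by (intro Max_in) auto
    then obtain q where q: "q \<in> A" "M = h q y" by auto
    have sum: "(\<Sum>p\<in>A. r p * c p y) \<le> card A * (N * h q y)"
    proof (rule order_trans[OF sum_mono])
      fix p assume p: "p \<in> A"
      have "h p y \<le> h q y" unfolding q(2)[symmetric] M_def using Cons.prems p by (intro Max_ge) auto
      then have "N * h p y \<le> N * h q y" using N by (rule mult_left_mono)
      then show "r p * c p y \<le> N * h q y" using Cons.prems(1)[of p y] p by auto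
    qed simp
    \<comment> \<open>Initial sites get rank 0, \<open>y\<close> gets rank 1, and later sites move
      up by two, so every parent stays below its children, including those of
      \<open>y\<close>.\<close>
    let ?par = "par(y := q)" and ?rk = "\<lambda>v. if v \<in> A then 0 else if v = y then 1 else Suc (Suc (rk v))"
    have cA: "card A \<ge> 1" using Cons.prems by (simp add: Suc_le_eq card_gt_0_iff)
    have fA: "fact (card A) = real (card A) * fact (card A - 1)"
      using cA by (cases "card A") auto
    have prod: "(\<Prod>v\<in>set (y # ys). h (?par v) v) = h q y * (\<Prod>v\<in>set ys. h (par v) v)"
      using yys by (auto intro!: prod.cong)
    have "growth_weight r c A (y # ys) * fact (card A - 1) =
        (\<Sum>p\<in>A. r p * c p y) * (growth_weight r c (insert y A) ys * fact (card A - 1))" by simp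
    also have "\<dots> \<le> card A * (N * h q y) * (growth_weight r c (insert y A) ys * fact (card A - 1))"
      using sum c by (intro mult_right_mono) (auto intro!: mult_nonneg_nonneg growth_weight_nonneg)
    also have "\<dots> = N * h q y * (growth_weight r c (insert y A) ys * fact (card A))"
      by (simp only: fA mult_ac)
    also have "\<dots> \<le> N * h q y * (fact (card A + length ys) * (N ^ length ys * (\<Prod>v\<in>set ys. h (par v) v)))"
      using le N h by (intro mult_left_mono) auto
    also have "\<dots> = fact (card A - 1 + length (y # ys)) * (N ^ length (y # ys) * (\<Prod>v\<in>set (y # ys). h (?par v) v))"
    proof -
      have "card A - 1 + length (y # ys) = card A + length ys" using cA by simp
      then show ?thesis by (simp only: prod length_Cons power_Suc mult_ac)
    qed
    finally have "growth_weight r c A (y # ys) * fact (card A - 1) \<le>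
        fact (card A - 1 + length (y # ys)) * (N ^ length (y # ys) * (\<Prod>v\<in>set (y # ys). h (?par v) v))" .
    moreover have "\<forall>v\<in>set (y # ys). ?par v \<in> A \<union> set (y # ys) \<and> ?rk (?par v) < ?rk v \<and> 0 < ?rk v"
      using q par rk yA yys Cons.prems(5) by auto
    ultimately show ?case by (intro exI[of _ ?par] exI[of _ ?rk] conjI) auto
  qed
  then show ?thesis using that by blast
qed

text \<open>Hitting probabilities along tree edges are turned into lengths, the tree into a path by
  \<open>tree_to_path\<close>, and the lengths back into hitting probabilities. The resulting path
  is one term of the sum over orderings.\<close>

lemma tree_weight_le_path_weight:
  fixes L :: "(int ^ 'd) set"
  assumes cC: "c > 0" "C > 0"
    "\<And>x y :: int ^ 'd. x \<noteq> y \<Longrightarrow> c / eucl x y ^ k \<le> hit x y"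
    "\<And>x y :: int ^ 'd. x \<noteq> y \<Longrightarrow> hit x y \<le> C / eucl x y ^ k"
    and L: "finite L" "0 \<notin> L"
    and par: "\<And>v. v \<in> L \<Longrightarrow> par v \<in> insert 0 L" "\<And>v. v \<in> L \<Longrightarrow> rk (par v) < (rk v :: nat)"
  shows "(\<Prod>v\<in>L. hit (par v) v) \<le>
    (C * 2 ^ k / c) ^ card L * fact (card L) ^ k * (\<Sum>\<gamma>\<in>permutations_of_set L. path_weight \<gamma>)"
proof -
  let ?m = "card L"
  have D0: "insert 0 L - {0} = L" using L by auto
  have card: "card (insert 0 L) - 1 = ?m" using L by simp
  have hit_nonneg: "hit x y \<ge> 0" for x y :: "int ^ 'd" by (simp add: hit_def)
  have eucl_refl: "eucl x x = 0" for x :: "int ^ 'd" by (simp add: eucl_sq)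
  obtain xs where xs: "distinct (0 # xs)" "set (0 # xs) = insert 0 L"
    and le: "chain_prod eucl (0 # xs) \<le> 2 ^ ?m * fact ?m * (\<Prod>v\<in>L. eucl (par v) v)"
    by (rule tree_to_path[where D = eucl and V = "insert 0 L" and r = 0 and par = par and rk = rk,
            OF eucl_nonneg eucl_refl eucl_commute eucl_triangle, unfolded D0 card])
       (use L par in auto)
  have "set xs = set (0 # xs) - {0}" using xs(1) by auto
  then have xsL: "set xs = L" by (simp only: xs(2) D0)
  then have len: "length xs = ?m" using xs distinct_card[of xs] by simp
  let ?E = "\<Prod>v\<in>L. eucl (par v) v" and ?P = "chain_prod eucl (0 # xs)"
  have neq: "par v \<noteq> v" if "v \<in> L" for v using par(2)[OF that] by auto
  have E: "?E > 0" using neq by (intro prod_pos) (auto intro: eucl_pos)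
  have P: "?P > 0" and h: "c ^ ?m \<le> chain_prod hit (0 # xs) * ?P ^ k"
    using chain_prod_le_power[of c eucl k hit, OF cC(1) eucl_pos cC(3) xs(1)] by (auto simp: len)
  have "(\<Prod>v\<in>L. hit (par v) v) \<le> (\<Prod>v\<in>L. C / eucl (par v) v ^ k)"
    using cC(4) neq by (intro prod_mono) (auto simp: hit_nonneg)
  also have "\<dots> = C ^ ?m / ?E ^ k" by (simp add: prod_dividef prod_power_distrib)
  also have "\<dots> \<le> C ^ ?m * (2 ^ ?m * fact ?m) ^ k / ?P ^ k"
  proof -
    have "?P ^ k \<le> (2 ^ ?m * fact ?m * ?E) ^ k" using le P by (intro power_mono) auto
    then have "C ^ ?m * ?P ^ k \<le> C ^ ?m * (2 ^ ?m * fact ?m * ?E) ^ k" using cC(2) by (intro mult_left_mono) auto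
    then show ?thesis using E P by (simp add: divide_le_eq le_divide_eq power_mult_distrib mult_ac)
  qed
  also have "\<dots> \<le> C ^ ?m * (2 ^ ?m * fact ?m) ^ k * (chain_prod hit (0 # xs) / c ^ ?m)"
  proof -
    have "1 / ?P ^ k \<le> chain_prod hit (0 # xs) / c ^ ?m"
      using h P cC(1) by (simp add: field_simps)
    then have "C ^ ?m * (2 ^ ?m * fact ?m) ^ k * (1 / ?P ^ k) \<le>
        C ^ ?m * (2 ^ ?m * fact ?m) ^ k * (chain_prod hit (0 # xs) / c ^ ?m)"
      using cC(2) by (intro mult_left_mono) auto
    then show ?thesis by simp
  qed
  also have "\<dots> = (C * 2 ^ k / c) ^ ?m * fact ?m ^ k * chain_prod hit (0 # xs)"
    by (simp add: power_mult_distrib power_divide power_mult[symmetric] mult_ac)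
  also have "chain_prod hit (0 # xs) \<le> (\<Sum>\<gamma>\<in>permutations_of_set L. path_weight \<gamma>)"
  proof -
    have "xs \<in> permutations_of_set L" using xs xsL by (auto simp: permutations_of_set_def)
    then have "path_weight xs \<le> (\<Sum>\<gamma>\<in>permutations_of_set L. path_weight \<gamma>)"
      by (intro member_le_sum) (auto simp: path_weight_eq chain_prod_nonneg hit_nonneg L)
    then show ?thesis by (simp add: path_weight_eq)
  qed
  finally show ?thesis using cC(1,2) by (simp add: mult_left_mono)
qed

text \<open>Of the factorials, \<open>k\<close> come from replacing trees by paths, one from the
  choice of parents and one from the number of orders of discovery, since \<open>?W\<close> is the
  same for all of them.\<close>

lemma growth_sum_le_path_weight:
  fixes L :: "(int ^ 'd) set" and N :: real
  assumes cC: "c > 0" "C > 0"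
    "\<And>x y :: int ^ 'd. x \<noteq> y \<Longrightarrow> c / eucl x y ^ k \<le> hit x y"
    "\<And>x y :: int ^ 'd. x \<noteq> y \<Longrightarrow> hit x y \<le> C / eucl x y ^ k"
    and L: "finite L" "0 \<notin> L" and N: "N \<ge> 0" and q: "\<And>p y. q p y \<ge> 0"
    and rq: "\<And>p y. p \<in> insert 0 L \<Longrightarrow> real (r p) * q p y \<le> N * hit p y"
  shows "(\<Sum>\<gamma>\<in>permutations_of_set L. growth_weight r q {0} \<gamma>) \<le>
    (N * (C * 2 ^ k / c)) ^ card L * fact (card L) ^ (k + 2) * (\<Sum>\<gamma>\<in>permutations_of_set L. path_weight \<gamma>)"
proof -
  let ?m = "card L" and ?Z = "\<Sum>\<gamma>\<in>permutations_of_set L. path_weight \<gamma>"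
  let ?W = "fact ?m * (N ^ ?m * ((C * 2 ^ k / c) ^ ?m * fact ?m ^ k * ?Z))"
  have "growth_weight r q {0} ys \<le> ?W" if "ys \<in> permutations_of_set L" for ys
  proof -
    have ys: "set ys = L" "distinct ys" using that by (auto simp: permutations_of_set_def)
    have len: "length ys = ?m" using distinct_card[OF ys(2)] ys(1) by simp
    obtain par and rk :: "int ^ 'd \<Rightarrow> nat" where
      par: "\<And>v. v \<in> L \<Longrightarrow> par v \<in> {0} \<union> L" "\<And>v. v \<in> L \<Longrightarrow> rk (par v) < rk v" and
      le: "growth_weight r q {0} ys * fact (card {0 :: int ^ 'd} - 1) \<le>
        fact (card {0 :: int ^ 'd} - 1 + length ys) * (N ^ length ys * (\<Prod>v\<in>L. hit (par v) v))"
      by (rule growth_weight_le_tree[of hit q N "{0}" ys r, unfolded ys(1)])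
         (use N q rq L ys in \<open>auto simp: hit_def\<close>)
    have "growth_weight r q {0} ys \<le> fact ?m * (N ^ ?m * (\<Prod>v\<in>L. hit (par v) v))"
      using le by (simp add: len)
    also have "\<dots> \<le> ?W"
      using tree_weight_le_path_weight[OF cC L, of par rk] par N by (intro mult_left_mono) auto
    finally show ?thesis .
  qed
  then have "(\<Sum>\<gamma>\<in>permutations_of_set L. growth_weight r q {0} \<gamma>) \<le> (\<Sum>\<gamma>\<in>permutations_of_set L. ?W)"
    by (rule sum_mono)
  also have "\<dots> = fact ?m * ?W" using L by simp
  also have "\<dots> = (N * (C * 2 ^ k / c)) ^ ?m * fact ?m ^ (k + 2) * ?Z"
    by (simp only: power_mult_distrib[of N] power_add power2_eq_square mult_ac)
  finally show ?thesis .
qed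

section \<open>Assembly of the visit, tree and path estimates\<close>

theorem proposition1p5:
  assumes "CARD('d::finite) \<ge> 3"
  shows "\<exists>c::real. c > 0 \<and>
    (\<forall>(\<Lambda> :: (int ^ 'd) set) (n :: int ^ 'd \<Rightarrow> nat).
      finite \<Lambda> \<longrightarrow> \<Lambda> \<noteq> {} \<longrightarrow> (\<forall>z\<in>\<Lambda>. n z > 0) \<longrightarrow>
      \<P>(\<omega> in walk 0. \<forall>z\<in>\<Lambda>. local_time \<omega> z = of_nat (n z))
        \<le> (c * real (Max (n ` \<Lambda>))) ^ card \<Lambda> * (fact (card \<Lambda>)) ^ CARD('d)
           * exp (- real (Min (n ` \<Lambda>)) * capacity \<Lambda>)
           * (\<Sum>\<gamma>\<in>permutations_of_set (\<Lambda> - {0}). path_weight \<gamma>))"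
proof -
  obtain c C where cC: "c > 0" "C > 0"
    "\<And>x y :: int ^ 'd. x \<noteq> y \<Longrightarrow> c / eucl x y ^ (CARD('d) - 2) \<le> hit x y"
    "\<And>x y :: int ^ 'd. x \<noteq> y \<Longrightarrow> hit x y \<le> C / eucl x y ^ (CARD('d) - 2)"
    using hit_bounds[OF assms] by blast
  \<comment> \<open>The maximum with 1 permits raising the exponent from
    \<open>card (\<Lambda> - {0})\<close> to \<open>card \<Lambda>\<close> at the end.\<close>
  define B where "B = max 1 (C * 2 ^ (CARD('d) - 2) / c)"
  have B: "B \<ge> 1" "C * 2 ^ (CARD('d) - 2) / c \<le> B" by (auto simp: B_def)
  \<comment> \<open>One \<open>exp 1\<close> pays for dividing return probabilities by
    \<open>b\<close>, the other for the final escape.\<close>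
  have main: "\<P>(\<omega> in walk 0. \<forall>z\<in>\<Lambda>. local_time \<omega> z = of_nat (n z))
        \<le> (exp 1 * exp 1 * B * real (Max (n ` \<Lambda>))) ^ card \<Lambda> * (fact (card \<Lambda>)) ^ CARD('d)
           * exp (- real (Min (n ` \<Lambda>)) * capacity \<Lambda>)
           * (\<Sum>\<gamma>\<in>permutations_of_set (\<Lambda> - {0}). path_weight \<gamma>)"
    if \<Lambda>: "finite \<Lambda>" "\<Lambda> \<noteq> {}" and n: "\<And>z. z \<in> \<Lambda> \<Longrightarrow> n z > 0"
    for \<Lambda> :: "(int ^ 'd) set" and n :: "int ^ 'd \<Rightarrow> nat"
  proof -
    define L where "L = \<Lambda> - {0}"
    have L: "finite L" "0 \<notin> L" using \<Lambda> by (auto simp: L_def)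
    let ?Z = "\<Sum>\<gamma>\<in>permutations_of_set L. path_weight \<gamma>"
    have Z: "?Z \<ge> 0"
      by (intro sum_nonneg) (auto simp: path_weight_eq hit_def intro!: chain_prod_nonneg)
    \<comment> \<open>Visits after time zero: the start at the origin already accounts for one visit
      when the origin belongs to \<open>\<Lambda>\<close>.\<close>
    define m where "m z = (if z \<in> \<Lambda> then n z - (if z = 0 then 1 else 0) else 0)" for z
    define r where "r = m(0 := m 0 + 1)"
    have r: "r z = (if z \<in> \<Lambda> then n z else if z = 0 then 1 else 0)" for z
      using n by (auto simp: r_def m_def Suc_leI)
    define b where "b z = exp (- escape \<Lambda> z)" for z
    define q where "q x y = return_prob \<Lambda> x y / b x" for x y
    have b: "b z > 0" "b z \<le> 1" for z by (simp_all add: b_def escape_nonneg)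
    have q0: "q x y \<ge> 0" for x y by (simp add: q_def return_prob_nonneg b less_imp_le)
    have q_le: "q x y \<le> exp 1 * hit x y" for x y
    proof -
      have "q x y = exp (escape \<Lambda> x) * return_prob \<Lambda> x y"
        by (simp add: q_def b_def exp_minus field_simps)
      also have "\<dots> \<le> exp 1 * hit x y"
        by (intro mult_mono) (auto simp: escape_le_1 return_prob_le_hit return_prob_nonneg)
      finally show ?thesis .
    qed
    define N where "N = real (Max (n ` \<Lambda>))"
    have n_le: "real (n z) \<le> N" if "z \<in> \<Lambda>" for z
      using \<Lambda> that by (simp add: N_def)
    have N1: "N \<ge> 1"
    proof -
      obtain z where z: "z \<in> \<Lambda>" using \<Lambda> by auto
      then show ?thesis using n_le[OF z] n[OF z] by linarith
    qed
    let ?k = "card \<Lambda>"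
    have "\<P>(\<omega> in walk 0. \<forall>z\<in>\<Lambda>. local_time \<omega> z = of_nat (n z)) = \<P>(\<omega> in walk 0. \<omega> \<in> visits \<Lambda> m)"
    proof (rule walk_prob_cong)
      show "AE \<omega> in walk 0. (\<forall>z\<in>\<Lambda>. local_time \<omega> z = of_nat (n z)) \<longleftrightarrow> \<omega> \<in> visits \<Lambda> m"
        using AE_walk_start[of 0]
      proof eventually_elim
        case (elim \<omega>)
        have "local_time \<omega> z = of_nat (n z) \<longleftrightarrow> local_time (shift 1 \<omega>) z = of_nat (m z)" if z: "z \<in> \<Lambda>" for z
        proof (cases "z = 0")
          case True
          have "(of_nat (n z) :: ennreal) = 1 + of_nat (m z)"
          proof -
            have "n z = Suc (m z)" using n[OF z] True z by (simp add: m_def)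
            then show ?thesis by simp
          qed
          then show ?thesis
            using local_time_split[of \<omega> z 1] elim True by (simp add: ennreal_add_left_cancel)
        next
          case False
          then show ?thesis using local_time_split[of \<omega> z 1] elim z by (simp add: m_def)
        qed
        then show ?case by (auto simp: visits_def)
      qed
      show "Measurable.pred (walk 0) (\<lambda>\<omega>. \<forall>z\<in>\<Lambda>. local_time \<omega> z = of_nat (n z))"
        using \<Lambda>(1) by measurable
      show "Measurable.pred (walk 0) (\<lambda>\<omega>. \<omega> \<in> visits \<Lambda> m)"
        using sets_visits[OF \<Lambda>(1), of m] by (simp add: pred_def sets_walk)
    qed
    also have "\<dots> = measure (walk 0) (visits \<Lambda> m)" by simp
    \<comment> \<open>The origin is the only discovered site at the start and the root of the tree,
      whether or not it lies in \<open>\<Lambda>\<close>; hence the ambient set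
      \<open>insert 0 \<Lambda>\<close>.\<close>
    also have "\<dots> \<le> exp 1 * (\<Prod>z\<in>insert 0 \<Lambda>. b z ^ r z) * growth_sum r q \<Lambda> {0}"
      unfolding r_def b_def[abs_def] q_def[abs_def]
      by (rule visits_bound) (use \<Lambda> n in \<open>auto simp: m_def\<close>)
    also have "\<dots> \<le> exp 1 * exp (- real (Min (n ` \<Lambda>)) * capacity \<Lambda>) *
        ((N * exp 1 * (C * 2 ^ (CARD('d) - 2) / c)) ^ card L * fact (card L) ^ (CARD('d) - 2 + 2) * ?Z)"
    proof (intro mult_mono)
      \<comment> \<open>An origin outside \<open>\<Lambda>\<close> contributes a factor at most
        1.\<close>
      have "(\<Prod>z\<in>insert 0 \<Lambda>. b z ^ r z) \<le> (\<Prod>z\<in>\<Lambda>. b z ^ r z)"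
      proof (cases "0 \<in> \<Lambda>")
        case False
        have "b 0 ^ r 0 \<le> 1" using b by (intro power_le_one) (auto intro: less_imp_le)
        moreover have "(\<Prod>z\<in>\<Lambda>. b z ^ r z) \<ge> 0" using b by (intro prod_nonneg) (auto intro: less_imp_le)
        ultimately show ?thesis using False \<Lambda>(1) by (simp add: mult_left_le_one_le b less_imp_le)
      qed (simp add: insert_absorb)
      also have "\<dots> \<le> (\<Prod>z\<in>\<Lambda>. b z ^ Min (n ` \<Lambda>))"
        using b \<Lambda> by (intro prod_mono conjI power_decreasing) (auto simp: r intro: less_imp_le)
      also have "\<dots> = exp (- real (Min (n ` \<Lambda>)) * capacity \<Lambda>)"
      proof -
        let ?M = "Min (n ` \<Lambda>)"
        have "(\<Prod>z\<in>\<Lambda>. b z ^ ?M) = (\<Prod>z\<in>\<Lambda>. exp (real ?M * (- escape \<Lambda> z)))"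
          by (simp only: b_def exp_of_nat_mult)
        also have "\<dots> = exp (\<Sum>z\<in>\<Lambda>. real ?M * (- escape \<Lambda> z))"
          by (rule exp_sum[OF \<Lambda>(1), symmetric])
        also have "(\<Sum>z\<in>\<Lambda>. real ?M * (- escape \<Lambda> z)) = - real ?M * capacity \<Lambda>"
          by (simp add: capacity_def escape_def sum_distrib_left sum_negf)
        finally show ?thesis .
      qed
      finally show "(\<Prod>z\<in>insert 0 \<Lambda>. b z ^ r z) \<le> exp (- real (Min (n ` \<Lambda>)) * capacity \<Lambda>)" .
      have "real (r p) * q p y \<le> N * exp 1 * hit p y" if "p \<in> insert 0 L" for p y
      proof -
        have "real (r p) \<le> N" using n_le N1 by (auto simp: r)
        then have "real (r p) * q p y \<le> N * (exp 1 * hit p y)"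
          using q_le q0 N1 by (intro mult_mono) auto
        then show ?thesis by (simp add: mult.assoc)
      qed
      then show "growth_sum r q \<Lambda> {0} \<le>
          (N * exp 1 * (C * 2 ^ (CARD('d) - 2) / c)) ^ card L * fact (card L) ^ (CARD('d) - 2 + 2) * ?Z"
        unfolding growth_sum_def L_def[symmetric]
        using N1 q0 by (intro growth_sum_le_path_weight[OF cC L]) auto
    qed (auto intro!: growth_sum_nonneg q0 prod_nonneg zero_le_power less_imp_le[OF b(1)])
    also have "\<dots> \<le> exp 1 * exp (- real (Min (n ` \<Lambda>)) * capacity \<Lambda>) *
        ((N * exp 1 * B) ^ ?k * fact ?k ^ CARD('d) * ?Z)"
    proof (intro mult_left_mono mult_right_mono mult_mono)
      have "card L \<le> ?k" unfolding L_def by (rule card_mono) (use \<Lambda> in auto)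
      moreover have "CARD('d) - 2 + 2 = CARD('d)" using assms by simp
      ultimately show "fact (card L) ^ (CARD('d) - 2 + 2) \<le> (fact ?k :: real) ^ CARD('d)"
        by (simp only:) (intro power_mono fact_mono, auto)
      have "N * exp 1 \<ge> 1" using N1 mult_mono[of 1 N 1 "exp 1"] by simp
      then have "N * exp 1 * B \<ge> 1" using B mult_mono[of 1 "N * exp 1" 1 B] by simp
      have "(N * exp 1 * (C * 2 ^ (CARD('d) - 2) / c)) ^ card L \<le> (N * exp 1 * B) ^ card L"
        using B N1 cC(1,2) by (intro power_mono mult_left_mono) auto
      also have "\<dots> \<le> (N * exp 1 * B) ^ ?k"
        using \<open>card L \<le> ?k\<close> \<open>N * exp 1 * B \<ge> 1\<close> by (rule power_increasing)
      finally show "(N * exp 1 * (C * 2 ^ (CARD('d) - 2) / c)) ^ card L \<le> (N * exp 1 * B) ^ ?k" .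
    qed (use B N1 Z in auto)
    \<comment> \<open>The single prefactor is absorbed into the power, because
      \<open>\<Lambda>\<close> is nonempty.\<close>
    also have "\<dots> \<le> exp 1 ^ ?k * exp (- real (Min (n ` \<Lambda>)) * capacity \<Lambda>) *
        ((N * exp 1 * B) ^ ?k * fact ?k ^ CARD('d) * ?Z)"
    proof (intro mult_right_mono)
      have "?k \<ge> 1" using \<Lambda> by (simp add: Suc_le_eq card_gt_0_iff)
      then show "exp 1 \<le> (exp 1 :: real) ^ ?k" by (intro self_le_power) auto
    qed (use B N1 Z in auto)
    also have "\<dots> = (exp 1 * exp 1 * B * N) ^ ?k * fact ?k ^ CARD('d)
        * exp (- real (Min (n ` \<Lambda>)) * capacity \<Lambda>) * ?Z"
      by (simp only: power_mult_distrib mult_ac)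
    finally show ?thesis unfolding N_def L_def .
  qed
  show ?thesis
    by (intro exI[of _ "exp 1 * exp 1 * B"] conjI allI impI main) (use B in auto)
qed

end
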